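(* Let $X$ be a scheme over $\mathbf{Q}$ endowed with a vector field $\vec{\mathscr{V}}$, and let $x\in X$. Then the ordered set $$\{\eta\in X \mid \eta\leadsto x \text{ and } \eta \text{ is a leaf of } (X,\vec{\mathscr{V}})\}$$ has a least element.
   Context: Rings are commutative with unit. A derivation of a ring is an additive map $\partial$ with $\partial(fg)=f\partial(g)+\partial(f)g$. A vector field $\vec{\mathscr{V}}$ on a scheme $X$ is a derivation of the structure sheaf $\mathscr{O}_X$, i.e. a family of derivations $\partial_U$ of the rings $\mathscr{O}_X(U)$, $U\subset X$ open, compatible with the restriction maps. It induces a derivation $\partial_x$ of each local ring $\mathscr{O}_{X,x}$. Let $\mathfrak{M}_x$ be the maximal ideal of $\mathscr{O}_{X,x}$ and $\kappa(x)=\mathscr{O}_{X,x}/\mathfrak{M}_x$. The tangent vector $\vec{\mathscr{V}}(x)\in T_xX=\mathrm{Hom}_{\kappa(x)}(\mathfrak{M}_x/\mathfrak{M}_x^2,\kappa(x))$ is the map induced by $f\mapsto \partial_x(f) \bmod \mathfrak{M}_x$. A point $\eta\in X$ is a leaf of $(X,\vec{\mathscr{V}})$ if $\vec{\mathscr{V}}(\eta)=0$. For points $z,y$ of $X$ write $z\leadsto y$ ("$z$ is a generization of $y$") if $y\in\overline{\{z\}}$. The order used is: $z\geq y$ if and only if $z\leadsto y$. *)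

theory Defs
  imports
    "HOL-Analysis.Abstract_Topology"
    "HOL-Algebra.QuotRing"
    "HOL-Algebra.Ideal_Product"
    "HOL-Algebra.Module"
begin

section \<open>Locally ringed spaces\<close>

text \<open>
  All rings of sections of a space have their elements in one common type \<^typ>\<open>'b\<close> but have their
  own carriers and operations; a set-indexed family of rings can always be presented in this
  way. The values of sections and restrictions at sets that are not open are irrelevant.
\<close>

record ('a, 'b) ringed_space =
  space_top :: "'a topology"
  sections :: "'a set \<Rightarrow> 'b ring"
  restr :: "'a set \<Rightarrow> 'a set \<Rightarrow> 'b \<Rightarrow> 'b"

abbreviation points :: "('a, 'b) ringed_space \<Rightarrow> 'a set" where
  "points X \<equiv> topspace (space_top X)"

abbreviation is_open :: "('a, 'b) ringed_space \<Rightarrow> 'a set \<Rightarrow> bool" where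
  "is_open X \<equiv> openin (space_top X)"

locale ringed_space =
  fixes X :: "('a, 'b) ringed_space"
  assumes sections_cring: "is_open X U \<Longrightarrow> cring (sections X U)"
    and restr_hom: "\<lbrakk>is_open X U; is_open X V; V \<subseteq> U\<rbrakk> \<Longrightarrow>
      restr X U V \<in> ring_hom (sections X U) (sections X V)"
    and restr_id: "\<lbrakk>is_open X U; s \<in> carrier (sections X U)\<rbrakk> \<Longrightarrow> restr X U U s = s"
    and restr_restr: "\<lbrakk>is_open X U; is_open X V; is_open X W; W \<subseteq> V; V \<subseteq> U;
        s \<in> carrier (sections X U)\<rbrakk> \<Longrightarrow> restr X V W (restr X U V s) = restr X U W s"
    and separated: "\<lbrakk>\<And>V. V \<in> \<V> \<Longrightarrow> is_open X V;
        s \<in> carrier (sections X (\<Union>\<V>)); t \<in> carrier (sections X (\<Union>\<V>));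
        \<And>V. V \<in> \<V> \<Longrightarrow> restr X (\<Union>\<V>) V s = restr X (\<Union>\<V>) V t\<rbrakk> \<Longrightarrow> s = t"
    and gluing: "\<lbrakk>\<And>V. V \<in> \<V> \<Longrightarrow> is_open X V; \<And>V. V \<in> \<V> \<Longrightarrow> \<sigma> V \<in> carrier (sections X V);
        \<And>V W. \<lbrakk>V \<in> \<V>; W \<in> \<V>\<rbrakk> \<Longrightarrow> restr X V (V \<inter> W) (\<sigma> V) = restr X W (V \<inter> W) (\<sigma> W)\<rbrakk>
      \<Longrightarrow> \<exists>s \<in> carrier (sections X (\<Union>\<V>)). \<forall>V\<in>\<V>. restr X (\<Union>\<V>) V s = \<sigma> V"

text \<open>
  The germ of \<open>s \<in> \<O>(U)\<close> at \<open>x\<close> is the class of \<open>(U, s)\<close> for the usual equivalence relation. The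
  operations on the stalk, and the maps between stalks below, are written as unions over all
  representatives; since the result does not depend on the representatives, these are unions of
  copies of one class.
\<close>

definition germ :: "('a, 'b) ringed_space \<Rightarrow> 'a \<Rightarrow> 'a set \<Rightarrow> 'b \<Rightarrow> ('a set \<times> 'b) set" where
  "germ X x U s = {(V, t). is_open X V \<and> x \<in> V \<and> t \<in> carrier (sections X V) \<and>
     (\<exists>W. is_open X W \<and> x \<in> W \<and> W \<subseteq> U \<inter> V \<and> restr X U W s = restr X V W t)}"

definition stalk :: "('a, 'b) ringed_space \<Rightarrow> 'a \<Rightarrow> ('a set \<times> 'b) set ring" where
  "stalk X x =
    \<lparr>carrier = {germ X x U s | U s. is_open X U \<and> x \<in> U \<and> s \<in> carrier (sections X U)},
     mult = (\<lambda>A B. \<Union>(U, s)\<in>A. \<Union>(V, t)\<in>B. germ X x (U \<inter> V)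
        (restr X U (U \<inter> V) s \<otimes>\<^bsub>sections X (U \<inter> V)\<^esub> restr X V (U \<inter> V) t)),
     one = germ X x (points X) \<one>\<^bsub>sections X (points X)\<^esub>,
     zero = germ X x (points X) \<zero>\<^bsub>sections X (points X)\<^esub>,
     add = (\<lambda>A B. \<Union>(U, s)\<in>A. \<Union>(V, t)\<in>B. germ X x (U \<inter> V)
        (restr X U (U \<inter> V) s \<oplus>\<^bsub>sections X (U \<inter> V)\<^esub> restr X V (U \<inter> V) t))\<rparr>"

definition local_ring :: "('a, 'm) ring_scheme \<Rightarrow> bool" where
  "local_ring R \<longleftrightarrow> cring R \<and> (\<exists>!M. maximalideal M R)"

definition max_ideal :: "('a, 'm) ring_scheme \<Rightarrow> 'a set" where
  "max_ideal R = (THE M. maximalideal M R)"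

lemma max_ideal_maximal:
  assumes "local_ring R" shows "maximalideal (max_ideal R) R"
  using assms unfolding local_ring_def max_ideal_def by (metis theI')

locale locally_ringed_space = ringed_space +
  assumes stalk_local: "x \<in> points X \<Longrightarrow> local_ring (stalk X x)"

definition preimage :: "('a, 'b) ringed_space \<Rightarrow> ('a \<Rightarrow> 'c) \<Rightarrow> 'c set \<Rightarrow> 'a set" where
  "preimage X f V = {x \<in> points X. f x \<in> V}"

definition stalk_map ::
  "('a, 'b) ringed_space \<Rightarrow> ('a \<Rightarrow> 'c) \<Rightarrow> ('c set \<Rightarrow> 'd \<Rightarrow> 'b) \<Rightarrow> 'a \<Rightarrow>
    ('c set \<times> 'd) set \<Rightarrow> ('a set \<times> 'b) set" where
  "stalk_map X f \<phi> x A = (\<Union>(V, s)\<in>A. germ X x (preimage X f V) (\<phi> V s))"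

text \<open>
  A morphism consists of a continuous map \<open>f\<close> and the ring homomorphisms
  \<open>\<phi> V : \<O>\<^sub>Y(V) \<rightarrow> \<O>\<^sub>X(f\<^sup>-\<^sup>1 V)\<close>.
\<close>

locale lrs_morphism =
  X: locally_ringed_space X + Y: locally_ringed_space Y
  for X :: "('a, 'b) ringed_space" and Y :: "('c, 'd) ringed_space"
    and f :: "'a \<Rightarrow> 'c" and \<phi> :: "'c set \<Rightarrow> 'd \<Rightarrow> 'b" +
  assumes continuous: "continuous_map (space_top X) (space_top Y) f"
    and hom: "is_open Y V \<Longrightarrow> \<phi> V \<in> ring_hom (sections Y V) (sections X (preimage X f V))"
    and natural: "\<lbrakk>is_open Y U; is_open Y V; V \<subseteq> U; s \<in> carrier (sections Y U)\<rbrakk> \<Longrightarrow>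
      restr X (preimage X f U) (preimage X f V) (\<phi> U s) = \<phi> V (restr Y U V s)"
    and local: "\<lbrakk>x \<in> points X; A \<in> max_ideal (stalk Y (f x))\<rbrakk> \<Longrightarrow>
      stalk_map X f \<phi> x A \<in> max_ideal (stalk X x)"

locale lrs_isomorphism = lrs_morphism +
  assumes homeomorphic: "homeomorphic_map (space_top X) (space_top Y) f"
    and bij: "is_open Y V \<Longrightarrow>
      bij_betw (\<phi> V) (carrier (sections Y V)) (carrier (sections X (preimage X f V)))"

definition open_subspace :: "('a, 'b) ringed_space \<Rightarrow> 'a set \<Rightarrow> ('a, 'b) ringed_space" where
  "open_subspace X U = X\<lparr>space_top := subtopology (space_top X) U\<rparr>"


section \<open>The spectrum of a ring\<close>

definition zariski :: "('a, 'm) ring_scheme \<Rightarrow> 'a set topology" where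
  "zariski R = topology (\<lambda>U. \<exists>T \<subseteq> carrier R. U = {P. primeideal P R \<and> \<not> T \<subseteq> P})"

lemma istopology_zariski:
  "istopology (\<lambda>U. \<exists>T \<subseteq> carrier R. U = {P. primeideal P R \<and> \<not> T \<subseteq> P})"
  unfolding istopology_def
proof (intro conjI allI impI)
  fix U V
  assume "\<exists>T \<subseteq> carrier R. U = {P. primeideal P R \<and> \<not> T \<subseteq> P}"
    and "\<exists>T \<subseteq> carrier R. V = {P. primeideal P R \<and> \<not> T \<subseteq> P}"
  then obtain S T where S: "S \<subseteq> carrier R" "U = {P. primeideal P R \<and> \<not> S \<subseteq> P}"
    and T: "T \<subseteq> carrier R" "V = {P. primeideal P R \<and> \<not> T \<subseteq> P}"
    by auto
  let ?ST = "{s \<otimes>\<^bsub>R\<^esub> t | s t. s \<in> S \<and> t \<in> T \<and> s \<otimes>\<^bsub>R\<^esub> t \<in> carrier R}"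
  have "\<not> ?ST \<subseteq> P \<longleftrightarrow> \<not> S \<subseteq> P \<and> \<not> T \<subseteq> P" if "primeideal P R" for P
  proof -
    interpret primeideal P R by (rule that)
    show ?thesis
    proof
      assume "\<not> ?ST \<subseteq> P"
      then show "\<not> S \<subseteq> P \<and> \<not> T \<subseteq> P"
        using S(1) T(1) I_l_closed I_r_closed by blast
    next
      assume "\<not> S \<subseteq> P \<and> \<not> T \<subseteq> P"
      then obtain s t where "s \<in> S" "s \<notin> P" "t \<in> T" "t \<notin> P" by auto
      then have "s \<otimes>\<^bsub>R\<^esub> t \<in> ?ST" "s \<otimes>\<^bsub>R\<^esub> t \<notin> P"
        using S(1) T(1) I_prime by blast+
      then show "\<not> ?ST \<subseteq> P" by blast
    qed
  qed
  then have "U \<inter> V = {P. primeideal P R \<and> \<not> ?ST \<subseteq> P}"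
    using S(2) T(2) by blast
  then show "\<exists>T \<subseteq> carrier R. U \<inter> V = {P. primeideal P R \<and> \<not> T \<subseteq> P}"
    by (intro exI[of _ ?ST]) auto
next
  fix \<K>
  assume "\<forall>K\<in>\<K>. \<exists>T \<subseteq> carrier R. K = {P. primeideal P R \<and> \<not> T \<subseteq> P}"
  then obtain T where "\<And>K. K \<in> \<K> \<Longrightarrow> T K \<subseteq> carrier R \<and> K = {P. primeideal P R \<and> \<not> T K \<subseteq> P}"
    by metis
  then show "\<exists>T \<subseteq> carrier R. \<Union>\<K> = {P. primeideal P R \<and> \<not> T \<subseteq> P}"
    by (intro exI[of _ "\<Union>(T ` \<K>)"]) blast
qed

lemma openin_zariski:
  "openin (zariski R) U \<longleftrightarrow> (\<exists>T \<subseteq> carrier R. U = {P. primeideal P R \<and> \<not> T \<subseteq> P})"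
  by (simp add: zariski_def istopology_zariski)

text \<open>The fraction \<open>a/s\<close> in the localization at the prime \<open>P\<close>.\<close>

definition frac :: "('a, 'm) ring_scheme \<Rightarrow> 'a set \<Rightarrow> 'a \<Rightarrow> 'a \<Rightarrow> ('a \<times> 'a) set" where
  "frac R P a s = {(b, t). b \<in> carrier R \<and> t \<in> carrier R - P \<and>
     (\<exists>u \<in> carrier R - P. u \<otimes>\<^bsub>R\<^esub> (a \<otimes>\<^bsub>R\<^esub> t \<ominus>\<^bsub>R\<^esub> b \<otimes>\<^bsub>R\<^esub> s) = \<zero>\<^bsub>R\<^esub>)}"

definition localization :: "('a, 'm) ring_scheme \<Rightarrow> 'a set \<Rightarrow> ('a \<times> 'a) set ring" where
  "localization R P =
    \<lparr>carrier = {frac R P a s | a s. a \<in> carrier R \<and> s \<in> carrier R - P},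
     mult = (\<lambda>A B. \<Union>(a, s)\<in>A. \<Union>(b, t)\<in>B. frac R P (a \<otimes>\<^bsub>R\<^esub> b) (s \<otimes>\<^bsub>R\<^esub> t)),
     one = frac R P \<one>\<^bsub>R\<^esub> \<one>\<^bsub>R\<^esub>,
     zero = frac R P \<zero>\<^bsub>R\<^esub> \<one>\<^bsub>R\<^esub>,
     add = (\<lambda>A B. \<Union>(a, s)\<in>A. \<Union>(b, t)\<in>B.
        frac R P (a \<otimes>\<^bsub>R\<^esub> t \<oplus>\<^bsub>R\<^esub> b \<otimes>\<^bsub>R\<^esub> s) (s \<otimes>\<^bsub>R\<^esub> t))\<rparr>"

text \<open>
  A section over \<open>U\<close> is a function assigning to \<open>P \<in> U\<close> an element of the localization at \<open>P\<close>
  that is locally given by a single fraction; outside \<open>U\<close> it is \<open>undefined\<close>.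
\<close>

definition spec_sections ::
  "('a, 'm) ring_scheme \<Rightarrow> 'a set set \<Rightarrow> ('a set \<Rightarrow> ('a \<times> 'a) set) ring" where
  "spec_sections R U =
    \<lparr>carrier = {\<sigma> \<in> (\<Pi>\<^sub>E P\<in>U. carrier (localization R P)).
        \<forall>P\<in>U. \<exists>V. openin (zariski R) V \<and> P \<in> V \<and> V \<subseteq> U \<and>
          (\<exists>a\<in>carrier R. \<exists>s\<in>carrier R. \<forall>Q\<in>V. s \<notin> Q \<and> \<sigma> Q = frac R Q a s)},
     mult = (\<lambda>\<sigma> \<tau>. \<lambda>P\<in>U. \<sigma> P \<otimes>\<^bsub>localization R P\<^esub> \<tau> P),
     one = (\<lambda>P\<in>U. \<one>\<^bsub>localization R P\<^esub>),
     zero = (\<lambda>P\<in>U. \<zero>\<^bsub>localization R P\<^esub>),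
     add = (\<lambda>\<sigma> \<tau>. \<lambda>P\<in>U. \<sigma> P \<oplus>\<^bsub>localization R P\<^esub> \<tau> P)\<rparr>"

definition Spec :: "('a, 'm) ring_scheme \<Rightarrow> ('a set, 'a set \<Rightarrow> ('a \<times> 'a) set) ringed_space" where
  "Spec R = \<lparr>space_top = zariski R, sections = spec_sections R, restr = (\<lambda>U V \<sigma>. restrict \<sigma> V)\<rparr>"


section \<open>Schemes\<close>

text \<open>
  It is no restriction that the elements of \<open>R\<close> below have the same type \<^typ>\<open>'b\<close> as the sections
  of \<open>X\<close>: an isomorphism of \<open>U\<close> with \<open>Spec R\<close> identifies \<open>R\<close> with the ring of sections over \<open>U\<close>.
\<close>

locale scheme = locally_ringed_space X for X :: "('a, 'b) ringed_space" +
  assumes locally_affine: "x \<in> points X \<Longrightarrow>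
    \<exists>U. is_open X U \<and> x \<in> U \<and>
      (\<exists>(R :: 'b ring) f \<phi>. cring R \<and> lrs_isomorphism (open_subspace X U) (Spec R) f \<phi>)"

definition rat_ring :: "rat ring" where
  "rat_ring = \<lparr>carrier = UNIV, mult = (*), one = 1, zero = 0, add = (+)\<rparr>"

locale scheme_over_rat = scheme X + structure_morphism: lrs_morphism X "Spec rat_ring" f \<phi>
  for X :: "('a, 'b) ringed_space" and f :: "'a \<Rightarrow> rat set"
    and \<phi> :: "rat set set \<Rightarrow> (rat set \<Rightarrow> (rat \<times> rat) set) \<Rightarrow> 'b"

text \<open>\<open>generizes X z y\<close> is \<open>z \<leadsto> y\<close>. In the specialization order, \<open>y \<le> z\<close> iff \<open>z \<leadsto> y\<close>.\<close>

definition generizes :: "('a, 'b) ringed_space \<Rightarrow> 'a \<Rightarrow> 'a \<Rightarrow> bool" where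
  "generizes X z y \<longleftrightarrow> z \<in> points X \<and> y \<in> space_top X closure_of {z}"

definition specialization_order :: "('a, 'b) ringed_space \<Rightarrow> 'a gorder" where
  "specialization_order X = \<lparr>carrier = points X, eq = (=), le = (\<lambda>y z. generizes X z y)\<rparr>"


section \<open>Derivations, vector fields and leaves\<close>

locale derivation = cring R for R (structure) and d :: "'a \<Rightarrow> 'a" +
  assumes closed: "f \<in> carrier R \<Longrightarrow> d f \<in> carrier R"
    and additive: "\<lbrakk>f \<in> carrier R; g \<in> carrier R\<rbrakk> \<Longrightarrow> d (f \<oplus> g) = d f \<oplus> d g"
    and leibniz: "\<lbrakk>f \<in> carrier R; g \<in> carrier R\<rbrakk> \<Longrightarrow> d (f \<otimes> g) = f \<otimes> d g \<oplus> d f \<otimes> g"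

locale vector_field =
  fixes X :: "('a, 'b) ringed_space" and \<D> :: "'a set \<Rightarrow> 'b \<Rightarrow> 'b"
  assumes derivation: "is_open X U \<Longrightarrow> derivation (sections X U) (\<D> U)"
    and compatible: "\<lbrakk>is_open X U; is_open X V; V \<subseteq> U; s \<in> carrier (sections X U)\<rbrakk> \<Longrightarrow>
      restr X U V (\<D> U s) = \<D> V (restr X U V s)"

definition stalk_derivation :: "('a, 'b) ringed_space \<Rightarrow> ('a set \<Rightarrow> 'b \<Rightarrow> 'b) \<Rightarrow> 'a \<Rightarrow>
    ('a set \<times> 'b) set \<Rightarrow> ('a set \<times> 'b) set" where
  "stalk_derivation X \<D> x A = (\<Union>(U, s)\<in>A. germ X x U (\<D> U s))"

context ringed_space begin

lemma germ_eqI: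
  assumes "is_open X U" "is_open X V" "s \<in> carrier (sections X U)" "t \<in> carrier (sections X V)"
   "is_open X W" "x \<in> W" "W \<subseteq> U \<inter> V" "restr X U W s = restr X V W t"
  shows "germ X x U s = germ X x V t"
proof -
  have main: "germ X x U s \<subseteq> germ X x V t" if 
   "is_open X U" "is_open X V" "s \<in> carrier (sections X U)" "t \<in> carrier (sections X V)"
   "is_open X W" "x \<in> W" "W \<subseteq> U \<inter> V" "restr X U W s = restr X V W t" for U V s t
  proof clarify
    fix V' t' assume "(V', t') \<in> germ X x U s"
    then obtain W' where W': "is_open X V'" "x \<in> V'" "t' \<in> carrier (sections X V')"
      "is_open X W'" "x \<in> W'" "W' \<subseteq> U \<inter> V'" "restr X U W' s = restr X V' W' t'"
      by (auto simp: germ_def)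
    have o: "is_open X (W \<inter> W')" using W' that by auto
    have "restr X V (W \<inter> W') t = restr X W (W \<inter> W') (restr X V W t)"
      using restr_restr[of V W "W \<inter> W'" t] that o by auto
    also have "\<dots> = restr X U (W \<inter> W') s" using restr_restr[of U W "W \<inter> W'" s] that o by auto
    also have "\<dots> = restr X V' (W \<inter> W') t'" using restr_restr[of U W' "W \<inter> W'" s] that o W'
      restr_restr[of V' W' "W \<inter> W'" t'] by auto
    finally show "(V', t') \<in> germ X x V t" using W' that o unfolding germ_def
      by (auto intro!: exI[of _ "W \<inter> W'"])
  qed
  show ?thesis using main[of U V s t] main[of V U t s] assms by auto
qed

lemma germ_self: "is_open X U \<Longrightarrow> x \<in> U \<Longrightarrow> s \<in> carrier (sections X U) \<Longrightarrow> (U,s) \<in> germ X x U s"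
  by (auto simp: germ_def)

lemma stalk_derivation_germ:
  assumes "vector_field X D" "is_open X U" "x \<in> U" "s \<in> carrier (sections X U)"
  shows "stalk_derivation X D x (germ X x U s) = germ X x U (D U s)"
proof -
  interpret V: vector_field X D by fact
  have cl: "D V t \<in> carrier (sections X V)" if "is_open X V" "t \<in> carrier (sections X V)" for V t
    using that V.derivation derivation.closed by metis
  have "germ X x V (D V t) = germ X x U (D U s)" if t: "(V,t) \<in> germ X x U s" for V t
  proof -
    obtain W where W: "is_open X V" "x \<in> V" "t \<in> carrier (sections X V)"
      "is_open X W" "x \<in> W" "W \<subseteq> U \<inter> V" "restr X U W s = restr X V W t" using t by (auto simp: germ_def)
    show ?thesis using W assms cl
      by (intro germ_eqI[of _ _ _ _ W]) (auto simp: V.compatible)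
  qed
  then show ?thesis unfolding stalk_derivation_def using germ_self[OF assms(2-)] by blast
qed

end

definition residue_field :: "('a, 'm) ring_scheme \<Rightarrow> 'a set ring" where
  "residue_field R = R Quot max_ideal R"

abbreviation max_ideal_sq :: "('a, 'm) ring_scheme \<Rightarrow> 'a set" where
  "max_ideal_sq R \<equiv> ideal_prod R (max_ideal R) (max_ideal R)"

text \<open>
  The cotangent space of a local ring, as a vector space over the residue field. Its elements are
  the cosets of the square of the maximal ideal inside the maximal ideal. The fields mult and one
  of the record play no role in a module.
\<close>

definition cotangent_space :: "('a, 'm) ring_scheme \<Rightarrow> ('a set, 'a set) module" where
  "cotangent_space R =
    \<lparr>carrier = {max_ideal_sq R +>\<^bsub>R\<^esub> f | f. f \<in> max_ideal R},
     mult = undefined, one = undefined,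
     zero = max_ideal_sq R, add = set_add R,
     smult = (\<lambda>\<alpha> c. \<Union>a\<in>\<alpha>. \<Union>f\<in>c. max_ideal_sq R +>\<^bsub>R\<^esub> (a \<otimes>\<^bsub>R\<^esub> f))\<rparr>"

definition tangent_space :: "('a, 'm) ring_scheme \<Rightarrow> ('a set \<Rightarrow> 'a set) set" where
  "tangent_space R =
    {h \<in> carrier (cotangent_space R) \<rightarrow>\<^sub>E carrier (residue_field R).
      (\<forall>c\<in>carrier (cotangent_space R). \<forall>c'\<in>carrier (cotangent_space R).
         h (c \<oplus>\<^bsub>cotangent_space R\<^esub> c') = h c \<oplus>\<^bsub>residue_field R\<^esub> h c') \<and>
      (\<forall>\<alpha>\<in>carrier (residue_field R). \<forall>c\<in>carrier (cotangent_space R).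
         h (\<alpha> \<odot>\<^bsub>cotangent_space R\<^esub> c) = \<alpha> \<otimes>\<^bsub>residue_field R\<^esub> h c)}"

definition zero_tangent_vector :: "('a, 'm) ring_scheme \<Rightarrow> 'a set \<Rightarrow> 'a set" where
  "zero_tangent_vector R = (\<lambda>c\<in>carrier (cotangent_space R). \<zero>\<^bsub>residue_field R\<^esub>)"

text \<open>
  The map \<open>M/M\<^sup>2 \<rightarrow> \<kappa>\<close> induced by \<open>f \<mapsto> d f mod M\<close>; again the union is over all representatives
  of a coset, and all of them give the same residue class.
\<close>

definition induced_tangent_vector :: "('a, 'm) ring_scheme \<Rightarrow> ('a \<Rightarrow> 'a) \<Rightarrow> 'a set \<Rightarrow> 'a set" where
  "induced_tangent_vector R d =
    (\<lambda>c\<in>carrier (cotangent_space R). \<Union>f\<in>c. max_ideal R +>\<^bsub>R\<^esub> d f)"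

lemma induced_tangent_vector_in_tangent_space:
  assumes R: "local_ring R" and "derivation R d"
  shows "induced_tangent_vector R d \<in> tangent_space R"
    and "f \<in> max_ideal R \<Longrightarrow>
      induced_tangent_vector R d (max_ideal_sq R +>\<^bsub>R\<^esub> f) = max_ideal R +>\<^bsub>R\<^esub> d f"
proof -
  interpret derivation R d by fact
  interpret M: maximalideal "max_ideal R" R by (rule max_ideal_maximal[OF R])
  interpret S: ideal "max_ideal_sq R" R
    using ideal_prod_is_ideal M.ideal_axioms by blast
  let ?M = "max_ideal R" and ?S = "max_ideal_sq R"
  have SM: "?S \<subseteq> ?M"
    using ideal_prod_inter[OF M.ideal_axioms M.ideal_axioms] by auto
  have dS: "d s \<in> ?M" if "s \<in> ?S" for s
    using that
  proof (induct rule: ideal_prod.induct)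
    case (prod i j)
    then show ?case
      using closed leibniz M.I_l_closed M.I_r_closed M.Icarr M.a_closed by metis
  next
    case (sum s t)
    then show ?case using additive M.a_closed S.Icarr by metis
  qed
  have coset_eq: "?M +>\<^bsub>R\<^esub> a = ?M +>\<^bsub>R\<^esub> b" if "a = m \<oplus>\<^bsub>R\<^esub> b" "m \<in> ?M" "b \<in> carrier R" for a b m
    using that M.a_repr_independence'[of a b] a_rcosI[OF _ M.a_subset, of m b] by simp
  have scoset_eq: "?S +>\<^bsub>R\<^esub> a = ?S +>\<^bsub>R\<^esub> b" if "a = m \<oplus>\<^bsub>R\<^esub> b" "m \<in> ?S" "b \<in> carrier R" for a b m
    using that S.a_repr_independence'[of a b] a_rcosI[OF _ S.a_subset, of m b] by simp
  have elem: "\<exists>m\<in>?S. g = m \<oplus>\<^bsub>R\<^esub> f" if "g \<in> ?S +>\<^bsub>R\<^esub> f" for f g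
    using that by (auto simp: a_r_coset_def')
  have elemM: "\<exists>m\<in>?M. g = m \<oplus>\<^bsub>R\<^esub> f" if "g \<in> ?M +>\<^bsub>R\<^esub> f" for f g
    using that by (auto simp: a_r_coset_def')
  have ind: "induced_tangent_vector R d (?S +>\<^bsub>R\<^esub> f) = ?M +>\<^bsub>R\<^esub> d f" if f: "f \<in> ?M" for f
  proof -
    have "?M +>\<^bsub>R\<^esub> d g = ?M +>\<^bsub>R\<^esub> d f" if g: "g \<in> ?S +>\<^bsub>R\<^esub> f" for g
    proof -
      obtain m where m: "m \<in> ?S" "g = m \<oplus>\<^bsub>R\<^esub> f" using elem[OF g] by auto
      then have "d g = d m \<oplus>\<^bsub>R\<^esub> d f" using additive f M.Icarr S.Icarr by blast
      then show ?thesis using coset_eq[of "d g" "d m"] dS[OF m(1)] closed f M.Icarr by blast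
    qed
    moreover have "f \<in> ?S +>\<^bsub>R\<^esub> f" using S.a_rcos_self f M.Icarr by blast
    ultimately have "(\<Union>g\<in>?S +>\<^bsub>R\<^esub> f. ?M +>\<^bsub>R\<^esub> d g) = ?M +>\<^bsub>R\<^esub> d f" by blast
    then show ?thesis using f by (auto simp: induced_tangent_vector_def cotangent_space_def)
  qed
  then show "f \<in> max_ideal R \<Longrightarrow>
      induced_tangent_vector R d (max_ideal_sq R +>\<^bsub>R\<^esub> f) = max_ideal R +>\<^bsub>R\<^esub> d f" .
  have smult: "(?M +>\<^bsub>R\<^esub> a) \<odot>\<^bsub>cotangent_space R\<^esub> (?S +>\<^bsub>R\<^esub> f) = ?S +>\<^bsub>R\<^esub> (a \<otimes>\<^bsub>R\<^esub> f)"
    if a: "a \<in> carrier R" and f: "f \<in> ?M" for a f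
  proof -
    have "?S +>\<^bsub>R\<^esub> (b \<otimes>\<^bsub>R\<^esub> g) = ?S +>\<^bsub>R\<^esub> (a \<otimes>\<^bsub>R\<^esub> f)"
      if b: "b \<in> ?M +>\<^bsub>R\<^esub> a" and g: "g \<in> ?S +>\<^bsub>R\<^esub> f" for b g
    proof -
      obtain m where m: "m \<in> ?M" "b = m \<oplus>\<^bsub>R\<^esub> a" using elemM[OF b] by auto
      obtain n where n: "n \<in> ?S" "g = n \<oplus>\<^bsub>R\<^esub> f" using elem[OF g] by auto
      have c: "m \<in> carrier R" "n \<in> carrier R" "f \<in> carrier R" "b \<in> carrier R"
        using m n f a M.Icarr S.Icarr by auto
      have "b \<otimes>\<^bsub>R\<^esub> g = (b \<otimes>\<^bsub>R\<^esub> n \<oplus>\<^bsub>R\<^esub> m \<otimes>\<^bsub>R\<^esub> f) \<oplus>\<^bsub>R\<^esub> a \<otimes>\<^bsub>R\<^esub> f"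
        using c a by (simp add: m(2) n(2) l_distr r_distr a_ac)
      moreover have "b \<otimes>\<^bsub>R\<^esub> n \<oplus>\<^bsub>R\<^esub> m \<otimes>\<^bsub>R\<^esub> f \<in> ?S"
        using c m n f S.I_l_closed ideal_prod.prod S.a_closed by metis
      ultimately show ?thesis using scoset_eq a c by blast
    qed
    moreover have "f \<in> ?S +>\<^bsub>R\<^esub> f" "a \<in> ?M +>\<^bsub>R\<^esub> a" using S.a_rcos_self M.a_rcos_self f a M.Icarr by blast+
    ultimately have "(\<Union>b\<in>?M +>\<^bsub>R\<^esub> a. \<Union>g\<in>?S +>\<^bsub>R\<^esub> f. ?S +>\<^bsub>R\<^esub> (b \<otimes>\<^bsub>R\<^esub> g)) = ?S +>\<^bsub>R\<^esub> (a \<otimes>\<^bsub>R\<^esub> f)" by blast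
    then show ?thesis by (simp add: cotangent_space_def)
  qed
  show "induced_tangent_vector R d \<in> tangent_space R"
    unfolding tangent_space_def mem_Collect_eq
  proof (intro conjI ballI)
    show "induced_tangent_vector R d \<in> carrier (cotangent_space R) \<rightarrow>\<^sub>E carrier (residue_field R)"
    proof (rule PiE_I)
      fix c assume "c \<in> carrier (cotangent_space R)"
      then obtain f where "f \<in> ?M" "c = ?S +>\<^bsub>R\<^esub> f" by (auto simp: cotangent_space_def)
      then show "induced_tangent_vector R d c \<in> carrier (residue_field R)"
        using ind closed M.Icarr a_rcosetsI[OF M.a_subset]
        by (simp add: residue_field_def FactRing_def)
    qed (simp add: induced_tangent_vector_def)
  next
    fix c c' assume "c \<in> carrier (cotangent_space R)" "c' \<in> carrier (cotangent_space R)"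
    then obtain f f' where *: "f \<in> ?M" "c = ?S +>\<^bsub>R\<^esub> f" "f' \<in> ?M" "c' = ?S +>\<^bsub>R\<^esub> f'"
      by (auto simp: cotangent_space_def)
    then have "c \<oplus>\<^bsub>cotangent_space R\<^esub> c' = ?S +>\<^bsub>R\<^esub> (f \<oplus>\<^bsub>R\<^esub> f')"
      using S.a_rcos_sum M.Icarr by (simp add: cotangent_space_def)
    then show "induced_tangent_vector R d (c \<oplus>\<^bsub>cotangent_space R\<^esub> c') =
        induced_tangent_vector R d c \<oplus>\<^bsub>residue_field R\<^esub> induced_tangent_vector R d c'"
      using * ind M.Icarr M.a_closed additive closed M.a_rcos_sum
      by (simp add: residue_field_def FactRing_def)
  next
    fix \<alpha> c assume "\<alpha> \<in> carrier (residue_field R)" "c \<in> carrier (cotangent_space R)"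
    then obtain a f where *: "a \<in> carrier R" "\<alpha> = ?M +>\<^bsub>R\<^esub> a" "f \<in> ?M" "c = ?S +>\<^bsub>R\<^esub> f"
      by (auto simp: cotangent_space_def residue_field_def FactRing_def A_RCOSETS_def' a_r_coset_def')
    have c: "f \<in> carrier R" "d f \<in> carrier R" "d a \<in> carrier R" using * closed M.Icarr by auto
    have "induced_tangent_vector R d (\<alpha> \<odot>\<^bsub>cotangent_space R\<^esub> c) = ?M +>\<^bsub>R\<^esub> d (a \<otimes>\<^bsub>R\<^esub> f)"
      using * smult ind M.I_l_closed by simp
    also have "\<dots> = ?M +>\<^bsub>R\<^esub> (a \<otimes>\<^bsub>R\<^esub> d f)"
      using coset_eq[of _ "d a \<otimes>\<^bsub>R\<^esub> f" "a \<otimes>\<^bsub>R\<^esub> d f"] * c M.I_l_closed by (simp add: leibniz a_comm)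
    finally show "induced_tangent_vector R d (\<alpha> \<odot>\<^bsub>cotangent_space R\<^esub> c) =
        \<alpha> \<otimes>\<^bsub>residue_field R\<^esub> induced_tangent_vector R d c"
      using * c ind M.rcoset_mult_add by (simp add: residue_field_def FactRing_def)
  qed
qed

definition tangent_vector :: "('a, 'b) ringed_space \<Rightarrow> ('a set \<Rightarrow> 'b \<Rightarrow> 'b) \<Rightarrow> 'a \<Rightarrow>
    ('a set \<times> 'b) set set \<Rightarrow> ('a set \<times> 'b) set set" where
  "tangent_vector X \<D> x = induced_tangent_vector (stalk X x) (stalk_derivation X \<D> x)"

definition leaf :: "('a, 'b) ringed_space \<Rightarrow> ('a set \<Rightarrow> 'b \<Rightarrow> 'b) \<Rightarrow> 'a \<Rightarrow> bool" where
  "leaf X \<D> \<eta> \<longleftrightarrow> \<eta> \<in> points X \<and> tangent_vector X \<D> \<eta> = zero_tangent_vector (stalk X \<eta>)"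

end

theory Submission
  imports Defs "HOL-Algebra.Ring_Divisibility"
begin

text \<open>
  The generizations of \<open>x\<close> are the prime ideals of the local ring at \<open>x\<close>, where a
  smaller prime generizes a larger one, and the leaves among them are the primes that are stable under the
  derivation \<open>d\<close> induced by the vector field. So the least leaf should be the largest stable prime. The
  largest stable ideal inside the maximal ideal consists of the germs \<open>g\<close> such that \<open>d\<^sup>n g\<close> vanishes at
  \<open>x\<close> for every \<open>n\<close>. In characteristic zero this is the kernel of the Taylor map
  \<open>g \<mapsto> \<Sum>\<^sub>n (d\<^sup>n g)(x) t\<^sup>n / n!\<close>, a ring homomorphism to the power series over the residue field; these
  form a domain, so the ideal is prime. Its point is the least leaf.

  Primality is \<open>stable_core_prime\<close>, proved for any derivation and any prime ideal with residue
  characteristic zero by comparing leading terms of Taylor series (\<open>contact_mult_leading\<close>). It is applied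
  to the sections over a neighbourhood of \<open>x\<close> and the prime ideal of those that vanish at \<open>x\<close>;
  the hypothesis on the characteristic comes from the structure morphism
  (\<open>nat_multiple_nonvanishing\<close>).

  The geometric part speaks only about the vanishing of sections at points. Leaves are points at
  which vanishing is inherited by derivatives (\<open>leaf_iff\<close>), and an affine chart is described by its
  coordinate ring and the vanishing of its elements (\<open>affine_chart\<close>): primes are points, inclusions
  of primes are specializations, and every section \<open>s\<close> is locally a fraction in the form
  \<open>t s = a\<close> with \<open>a\<close> and \<open>t\<close> from the coordinate ring. This form is compatible with
  the Leibniz rule, so that stability can be transferred between the coordinate ring and the sections
  over arbitrary open sets.
\<close>

section \<open>Derivations and Taylor expansion\<close>

lemma (in cring) ideal_of_closed:
  assumes "I \<subseteq> carrier R" "\<zero> \<in> I" "\<And>a b. \<lbrakk>a \<in> I; b \<in> I\<rbrakk> \<Longrightarrow> a \<oplus> b \<in> I"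
    and "\<And>a b. \<lbrakk>a \<in> carrier R; b \<in> I\<rbrakk> \<Longrightarrow> a \<otimes> b \<in> I"
  shows "ideal I R"
proof (rule idealI)
  show "subgroup I (add_monoid R)"
  proof (rule add.subgroupI)
    fix a assume "a \<in> I"
    then have "(\<ominus> \<one>) \<otimes> a \<in> I" "(\<ominus> \<one>) \<otimes> a = \<ominus> a" using assms(1,4) by (auto simp: l_minus)
    then show "\<ominus> a \<in> I" by simp
  qed (use assms in auto)
  show "a \<otimes> x \<in> I" if "a \<in> I" "x \<in> carrier R" for a x
    using that assms(1,4) m_comm[of a x] by auto
qed (use assms ring_axioms in auto)

context derivation
begin

lemma derivation_zero: "d \<zero> = \<zero>"
proof -
  have "d \<zero> \<oplus> d \<zero> = d \<zero>" using additive[of \<zero> \<zero>] by simp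
  then show ?thesis using closed by (simp add: add.l_cancel_one)
qed

lemma funpow_closed: "a \<in> carrier R \<Longrightarrow> (d ^^ n) a \<in> carrier R"
  by (induction n) (auto intro: closed)

lemma funpow_additive:
  "\<lbrakk>a \<in> carrier R; b \<in> carrier R\<rbrakk> \<Longrightarrow> (d ^^ n) (a \<oplus> b) = (d ^^ n) a \<oplus> (d ^^ n) b"
  by (induction n) (auto simp: additive funpow_closed)

lemma funpow_zero: "(d ^^ n) \<zero> = \<zero>"
  by (induction n) (auto simp: derivation_zero)

text \<open>
  The filtration by order of contact with the zero locus of \<open>m\<close> along the flow of \<open>d\<close>. If
  \<open>R/m\<close> contains the rational numbers, it is the preimage of the \<open>t\<close>-adic filtration under the Taylor map
  \<open>a \<mapsto> \<Sum>\<^sub>n d\<^sup>n a t\<^sup>n / n!\<close> into the power series over \<open>R/m\<close>.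
\<close>

definition contact :: "'a set \<Rightarrow> nat \<Rightarrow> 'a set" where
  "contact m n = {a \<in> carrier R. \<forall>k<n. (d ^^ k) a \<in> m}"

lemma contact_Suc: "a \<in> contact m (Suc n) \<longleftrightarrow> a \<in> carrier R \<and> a \<in> m \<and> d a \<in> contact m n"
  by (auto simp: contact_def All_less_Suc2 funpow_Suc_right closed simp del: funpow.simps(2))

lemma contact_antimono: "n \<le> k \<Longrightarrow> contact m k \<subseteq> contact m n"
  by (auto simp: contact_def)

lemma contact_ideal:
  assumes "ideal m R"
  shows "ideal (contact m n) R"
proof -
  interpret m: ideal m R by fact
  have mult: "a \<otimes> b \<in> contact m n" if "a \<in> carrier R" "b \<in> contact m n" for a b
    using that
  proof (induction n arbitrary: a b)
    case 0
    then show ?case by (auto simp: contact_def)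
  next
    case (Suc n)
    have b: "b \<in> carrier R" "b \<in> m" "d b \<in> contact m n" "b \<in> contact m n"
      using Suc.prems subsetD[OF contact_antimono[of n "Suc n"]] by (auto simp: contact_Suc)
    have "a \<otimes> d b \<in> contact m n" "d a \<otimes> b \<in> contact m n"
      using Suc b closed by auto
    then have "d (a \<otimes> b) \<in> contact m n"
      using Suc.prems b closed by (auto simp: leibniz contact_def funpow_additive)
    then show ?case
      using Suc.prems b m.I_l_closed by (auto simp: contact_Suc)
  qed
  show ?thesis
    by (rule ideal_of_closed)
      (use mult in \<open>auto simp: contact_def funpow_additive funpow_zero\<close>)
qed

text \<open>
  The leading coefficient of a product of two power series is the product of the leading
  coefficients; here the factor \<open>c\<close> is the binomial coefficient \<open>i + j\<close> over \<open>i\<close>, because the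
  denominators \<open>n!\<close> are left out. Only \<open>c > 0\<close> matters later, so \<open>c\<close> is left unspecified. The
  induction peels off one derivative, \<open>d (f g) = f d g + d f g\<close>; this lowers the order of contact
  of one factor and follows Pascal's triangle.
\<close>

lemma contact_mult_leading:
  assumes m: "ideal m R" and "f \<in> contact m i" "g \<in> contact m j"
  shows "\<exists>c::nat. c > 0 \<and> (d ^^ (i + j)) (f \<otimes> g) \<ominus> add_pow R c ((d ^^ i) f \<otimes> (d ^^ j) g) \<in> m"
  using assms(2-)
proof (induction "i + j" arbitrary: i j f g)
  case 0
  interpret m: ideal m R by fact
  show ?case
    using 0 by (intro exI[of _ 1]) (auto simp: contact_def r_neg minus_eq)
next
  case (Suc n)
  interpret m: ideal m R by fact
  have c: "f \<in> carrier R" "g \<in> carrier R" "d f \<in> carrier R" "d g \<in> carrier R"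
    using Suc.prems closed by (auto simp: contact_def)
  define p where "p = (d ^^ i) f \<otimes> (d ^^ j) g"
  define u where "u = (d ^^ n) (f \<otimes> d g)"
  define v where "v = (d ^^ n) (d f \<otimes> g)"
  have pc: "p \<in> carrier R" "u \<in> carrier R" "v \<in> carrier R"
    using c funpow_closed by (auto simp: p_def u_def v_def)
  have sum: "(d ^^ (i + j)) (f \<otimes> g) = u \<oplus> v"
    using c by (simp add: Suc.hyps(2)[symmetric] funpow_Suc_right u_def v_def leibniz
        funpow_additive del: funpow.simps(2))
  have u: "\<exists>c::nat. c > 0 \<and> u \<ominus> add_pow R c p \<in> m" if j: "j = Suc j'" for j'
    using Suc.hyps(1)[of i j' f "d g"] Suc.prems Suc.hyps(2) j
    by (auto simp: contact_Suc u_def p_def funpow_Suc_right simp del: funpow.simps(2))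
  have v: "\<exists>c::nat. c > 0 \<and> v \<ominus> add_pow R c p \<in> m" if i: "i = Suc i'" for i'
    using Suc.hyps(1)[of i' j "d f" g] Suc.prems Suc.hyps(2) i
    by (auto simp: contact_Suc v_def p_def funpow_Suc_right simp del: funpow.simps(2))
  have "\<exists>c::nat. c > 0 \<and> (u \<oplus> v) \<ominus> add_pow R c p \<in> m"
  proof (cases i)
    case 0
    then obtain j' where j: "j = Suc j'" "j' = n" using Suc.hyps(2) by (cases j) auto
    obtain c :: nat where c': "c > 0" "u \<ominus> add_pow R c p \<in> m" using u j by auto
    \<comment> \<open>On the edge of the triangle, one of the two terms only contributes to \<open>m\<close>.\<close>
    have "d f \<otimes> g \<in> contact m j"
      using ideal.I_l_closed[OF contact_ideal[OF m]] Suc.prems c by auto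
    then have "v \<in> m" using j by (auto simp: v_def contact_def)
    moreover have "(u \<oplus> v) \<ominus> add_pow R c p = (u \<ominus> add_pow R c p) \<oplus> v"
      using pc by (simp add: minus_eq a_ac)
    ultimately show ?thesis using c' by (auto intro!: exI[of _ c])
  next
    case i: (Suc i')
    obtain c :: nat where c': "c > 0" "v \<ominus> add_pow R c p \<in> m" using v i by auto
    show ?thesis
    proof (cases j)
      case 0
      then have j: "i' = n" using Suc.hyps(2) i by auto
      have "f \<otimes> d g \<in> contact m i"
        using ideal.I_r_closed[OF contact_ideal[OF m]] Suc.prems c by auto
      then have "u \<in> m" using i j by (auto simp: u_def contact_def)
      moreover have "(u \<oplus> v) \<ominus> add_pow R c p = u \<oplus> (v \<ominus> add_pow R c p)"
        using pc by (simp add: minus_eq a_ac)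
      ultimately show ?thesis using c' by (auto intro!: exI[of _ c])
    next
      case (Suc j')
      then obtain b :: nat where b: "b > 0" "u \<ominus> add_pow R b p \<in> m" using u by auto
      have "add_pow R (b + c) p = add_pow R b p \<oplus> add_pow R c p"
        using pc by (simp add: add.nat_pow_mult)
      then have "(u \<oplus> v) \<ominus> add_pow R (b + c) p = (u \<ominus> add_pow R b p) \<oplus> (v \<ominus> add_pow R c p)"
        using pc by (simp add: minus_eq a_ac minus_add)
      then show ?thesis using b c' by (auto intro!: exI[of _ "b + c"])
    qed
  qed
  then show ?case by (simp add: sum p_def)
qed

text \<open>
  If \<open>m\<close> is an ideal, this is the largest ideal inside \<open>m\<close> that is mapped to itself by \<open>d\<close>; it is
  the intersection of the contact filtration.
\<close>

definition stable_core :: "'a set \<Rightarrow> 'a set" where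
  "stable_core m = {a \<in> carrier R. \<forall>n. (d ^^ n) a \<in> m}"

lemma stable_core_subset: "stable_core m \<subseteq> m"
proof
  fix a assume "a \<in> stable_core m"
  then have "(d ^^ 0) a \<in> m" unfolding stable_core_def by blast
  then show "a \<in> m" by simp
qed

lemma stable_core_closed:
  assumes "a \<in> stable_core m" shows "d a \<in> stable_core m"
proof -
  have "(d ^^ n) (d a) = (d ^^ Suc n) a" for n by (simp add: funpow_swap1)
  then show ?thesis using assms by (simp add: stable_core_def closed del: funpow.simps)
qed

lemma stable_core_ideal:
  assumes "ideal m R"
  shows "ideal (stable_core m) R"
proof -
  have eq: "stable_core m = \<Inter>(range (contact m))"
    by (auto simp: stable_core_def contact_def)
  show ?thesis unfolding eq by (rule i_Intersect) (auto intro: contact_ideal assms)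
qed

text \<open>
  If neither \<open>a\<close> nor \<open>b\<close> lies in the stable core, both have a finite order of contact. By
  \<open>contact_mult_leading\<close>, the leading coefficient of \<open>a b\<close> is a positive multiple of the product
  of their leading coefficients, and it is nonzero modulo \<open>m\<close>, since \<open>m\<close> is prime and \<open>R/m\<close> has
  characteristic zero. In positive characteristic the statement fails: for \<open>d = d/dt\<close> on
  polynomials in \<open>t\<close> over a field of characteristic \<open>p\<close>, the power \<open>t\<^sup>p\<close> lies in the stable core
  of \<open>(t)\<close> and \<open>t\<close> does not.
\<close>

theorem stable_core_prime:
  assumes m: "primeideal m R" and char: "\<And>c::nat. c > 0 \<Longrightarrow> add_pow R c \<one> \<notin> m"
  shows "primeideal (stable_core m) R"
proof (rule primeidealI)
  interpret m: primeideal m R by fact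
  show "ideal (stable_core m) R" by (rule stable_core_ideal) (rule m.ideal_axioms)
  show "carrier R \<noteq> stable_core m"
    using stable_core_subset m.I_notcarr m.a_subset by blast
  fix a b
  assume ab: "a \<in> carrier R" "b \<in> carrier R" "a \<otimes> b \<in> stable_core m"
  show "a \<in> stable_core m \<or> b \<in> stable_core m"
  proof (rule ccontr)
    assume "\<not> ?thesis"
    then have ex: "\<exists>i. (d ^^ i) a \<notin> m" "\<exists>j. (d ^^ j) b \<notin> m" using ab by (auto simp: stable_core_def)
    obtain i where i: "(d ^^ i) a \<notin> m" "a \<in> contact m i"
      using ex(1) ab exists_least_iff[of "\<lambda>i. (d ^^ i) a \<notin> m"] by (auto simp: contact_def)
    obtain j where j: "(d ^^ j) b \<notin> m" "b \<in> contact m j"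
      using ex(2) ab exists_least_iff[of "\<lambda>i. (d ^^ i) b \<notin> m"] by (auto simp: contact_def)
    define p where "p = (d ^^ i) a \<otimes> (d ^^ j) b"
    have p: "p \<in> carrier R" "p \<notin> m"
      using i(1) j(1) ab funpow_closed m.I_prime[of "(d ^^ i) a" "(d ^^ j) b"] by (auto simp: p_def)
    obtain c :: nat where c: "c > 0" "(d ^^ (i + j)) (a \<otimes> b) \<ominus> add_pow R c p \<in> m"
      using contact_mult_leading[OF m.ideal_axioms i(2) j(2)] by (auto simp: p_def)
    define w where "w = (d ^^ (i + j)) (a \<otimes> b)"
    have w: "w \<in> m" "w \<in> carrier R" using ab m.Icarr by (auto simp: w_def stable_core_def)
    have "add_pow R c p = w \<ominus> (w \<ominus> add_pow R c p)"
      using w p by (simp add: minus_eq minus_add r_neg2)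
    also have "\<dots> \<in> m" using w c by (auto simp: w_def minus_eq)
    finally have "(add_pow R c \<one>) \<otimes> p \<in> m" using p by (simp add: add_pow_ldistr)
    then show False using m.I_prime[of "add_pow R c \<one>" p] char[OF c(1)] p by auto
  qed
qed (rule is_cring)

end

section \<open>Local rings\<close>

lemma (in primeideal) mult_mem_iff:
  assumes "t \<in> carrier R" "t \<notin> I" "s \<in> carrier R"
  shows "t \<otimes> s \<in> I \<longleftrightarrow> s \<in> I"
  using assms I_prime[of t s] I_l_closed by blast

lemma (in cring) exists_maximalideal_above:
  assumes I: "ideal I R" "\<one> \<notin> I"
  obtains M where "maximalideal M R" "I \<subseteq> M"
proof -
  define \<A> where "\<A> = {J. ideal J R \<and> I \<subseteq> J \<and> \<one> \<notin> J}"
  have "\<exists>M\<in>\<A>. \<forall>J\<in>\<A>. M \<subseteq> J \<longrightarrow> J = M"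
  proof (rule subset_Zorn_nonempty)
    show "\<A> \<noteq> {}" using I by (auto simp: \<A>_def)
    fix \<C> assume C: "\<C> \<noteq> {}" "subset.chain \<A> \<C>"
    then have "subset.chain {J. ideal J R} \<C>"
      by (auto simp: pred_on.chain_def \<A>_def)
    then show "\<Union>\<C> \<in> \<A>"
      using chain_Union_is_ideal[of \<C>] C by (auto simp: pred_on.chain_def \<A>_def)
  qed
  then obtain M where "M \<in> \<A>" and "\<forall>J\<in>\<A>. M \<subseteq> J \<longrightarrow> J = M" by (rule bexE)
  then have M: "ideal M R" "I \<subseteq> M" "\<one> \<notin> M"
    and max: "\<lbrakk>ideal J R; \<one> \<notin> J; M \<subseteq> J\<rbrakk> \<Longrightarrow> J = M" for J
    by (auto simp: \<A>_def)
  have "maximalideal M R"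
  proof (rule maximalidealI[OF M(1)])
    show "carrier R \<noteq> M" using M(3) by auto
    show "J = M \<or> J = carrier R" if "ideal J R" "M \<subseteq> J" for J
      using max[of J] that ideal.one_imp_carrier[of J R] by blast
  qed
  then show ?thesis using that M by blast
qed

lemma local_ring_unit:
  assumes R: "local_ring R" and a: "a \<in> carrier R" "a \<notin> max_ideal R"
  obtains b where "b \<in> carrier R" "a \<otimes>\<^bsub>R\<^esub> b = \<one>\<^bsub>R\<^esub>"
proof -
  interpret cring R using R by (simp add: local_ring_def)
  have "\<one>\<^bsub>R\<^esub> \<in> PIdl\<^bsub>R\<^esub> a"
  proof (rule ccontr)
    assume "\<one>\<^bsub>R\<^esub> \<notin> PIdl\<^bsub>R\<^esub> a"
    then obtain M where M: "maximalideal M R" "PIdl\<^bsub>R\<^esub> a \<subseteq> M"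
      using exists_maximalideal_above cgenideal_ideal a(1) by blast
    then have "M = max_ideal R"
      using R max_ideal_maximal[OF R] unfolding local_ring_def by blast
    then show False using M(2) cgenideal_self[OF a(1)] a(2) by blast
  qed
  then obtain b where "b \<in> carrier R" "\<one>\<^bsub>R\<^esub> = b \<otimes>\<^bsub>R\<^esub> a" by (auto simp: cgenideal_def)
  then show ?thesis using that[of b] a(1) m_comm by auto
qed

text \<open>
  The tangent vector sends the class of \<open>f\<close> to the class of \<open>d f\<close>, and every cotangent class has a
  representative in the maximal ideal; so a leaf is a point whose maximal ideal is stable under the
  derivation.
\<close>

lemma induced_tangent_vector_zero_iff:
  assumes R: "local_ring R" and "derivation R d"
  shows "induced_tangent_vector R d = zero_tangent_vector R \<longleftrightarrow> d ` max_ideal R \<subseteq> max_ideal R"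
proof -
  interpret derivation R d by fact
  interpret M: maximalideal "max_ideal R" R by (rule max_ideal_maximal[OF R])
  have "max_ideal R +>\<^bsub>R\<^esub> d f = \<zero>\<^bsub>residue_field R\<^esub> \<longleftrightarrow> d f \<in> max_ideal R"
    if "f \<in> max_ideal R" for f
    using that M.rcos_const_imp_mem[of "d f"] M.a_rcos_const[of "d f"] closed M.Icarr
    by (auto simp: residue_field_def FactRing_def)
  moreover have "induced_tangent_vector R d = zero_tangent_vector R \<longleftrightarrow>
    (\<forall>f\<in>max_ideal R. max_ideal R +>\<^bsub>R\<^esub> d f = \<zero>\<^bsub>residue_field R\<^esub>)" (is "?l \<longleftrightarrow> ?r")
  proof
    assume eq: ?l
    show ?r
    proof
      fix f assume f: "f \<in> max_ideal R"
      then have "max_ideal_sq R +>\<^bsub>R\<^esub> f \<in> carrier (cotangent_space R)"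
        by (auto simp: cotangent_space_def)
      then show "max_ideal R +>\<^bsub>R\<^esub> d f = \<zero>\<^bsub>residue_field R\<^esub>"
        using induced_tangent_vector_in_tangent_space(2)[OF assms f] eq
        by (simp add: zero_tangent_vector_def)
    qed
  next
    assume ?r
    then have "induced_tangent_vector R d c = zero_tangent_vector R c"
      if "c \<in> carrier (cotangent_space R)" for c
      using that induced_tangent_vector_in_tangent_space(2)[OF assms]
      by (auto simp: zero_tangent_vector_def cotangent_space_def)
    then show ?l
      by (intro extensionalityI[of _ "carrier (cotangent_space R)"])
        (auto simp: induced_tangent_vector_def zero_tangent_vector_def)
  qed
  ultimately show ?thesis by auto
qed

text \<open>
  Evaluates the operations of stalks and localizations, which are written as unions over all pairs
  of representatives.
\<close>

lemma union_of_copies: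
  assumes "\<And>a b c d. \<lbrakk>(a, b) \<in> A; (c, d) \<in> B\<rbrakk> \<Longrightarrow> F a b c d = G" "A \<noteq> {}" "B \<noteq> {}"
  shows "(\<Union>(a, b)\<in>A. \<Union>(c, d)\<in>B. F a b c d) = G"
proof -
  obtain a b c d where "(a, b) \<in> A" "(c, d) \<in> B" using assms(2,3) by fast
  then show ?thesis using assms(1) by fastforce
qed

section \<open>Germs and vanishing of sections\<close>

text \<open>
  The value of \<open>s\<close> in the residue field at \<open>y\<close> is zero, expressed by the absence of an inverse of
  \<open>s\<close> near \<open>y\<close>. This form does not mention the stalk, and it therefore has the same meaning in a
  space and in an open subspace, whose stalks are different sets. Lemma \<open>vanishes_iff_germ\<close> is the
  comparison with the maximal ideal of the stalk.
\<close>

definition vanishes :: "('a, 'b) ringed_space \<Rightarrow> 'a \<Rightarrow> 'a set \<Rightarrow> 'b \<Rightarrow> bool" where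
  "vanishes X y U s \<longleftrightarrow> \<not> (\<exists>W t. is_open X W \<and> y \<in> W \<and> W \<subseteq> U \<and> t \<in> carrier (sections X W) \<and>
     restr X U W s \<otimes>\<^bsub>sections X W\<^esub> t = \<one>\<^bsub>sections X W\<^esub>)"

context ringed_space
begin

lemma restr_closed:
  "\<lbrakk>is_open X U; is_open X V; V \<subseteq> U; s \<in> carrier (sections X U)\<rbrakk> \<Longrightarrow>
    restr X U V s \<in> carrier (sections X V)"
  using restr_hom ring_hom_closed by metis

lemma germ_restr:
  assumes "is_open X U" "is_open X W" "x \<in> W" "W \<subseteq> U" "s \<in> carrier (sections X U)"
  shows "germ X x W (restr X U W s) = germ X x U s"
  using assms restr_closed by (intro germ_eqI[of _ _ _ _ W]) (auto simp: restr_id)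

lemma germ_eqD:
  assumes "germ X x U s = germ X x V t" "is_open X V" "x \<in> V" "t \<in> carrier (sections X V)"
  obtains W where "is_open X W" "x \<in> W" "W \<subseteq> U \<inter> V" "restr X U W s = restr X V W t"
proof -
  have "(V, t) \<in> germ X x U s" using germ_self[OF assms(2-)] assms(1) by simp
  then show ?thesis using that by (auto simp: germ_def)
qed

text \<open>
  The common core of the formulas for products and sums of germs: the operation \<open>oper\<close> commutes with
  restriction, so any two pairs of representatives give results that agree on a small neighbourhood.
\<close>

lemma germ_binop:
  fixes oper :: "'b ring \<Rightarrow> 'b \<Rightarrow> 'b \<Rightarrow> 'b"
  assumes closed: "\<And>U s t. \<lbrakk>is_open X U; s \<in> carrier (sections X U); t \<in> carrier (sections X U)\<rbrakk> \<Longrightarrow>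
      oper (sections X U) s t \<in> carrier (sections X U)"
    and restr: "\<And>U V s t. \<lbrakk>is_open X U; is_open X V; V \<subseteq> U; s \<in> carrier (sections X U);
      t \<in> carrier (sections X U)\<rbrakk> \<Longrightarrow>
      restr X U V (oper (sections X U) s t) = oper (sections X V) (restr X U V s) (restr X U V t)"
    and U: "is_open X U" "x \<in> U" "s \<in> carrier (sections X U)" "t \<in> carrier (sections X U)"
  shows "(\<Union>(V, s')\<in>germ X x U s. \<Union>(W, t')\<in>germ X x U t. germ X x (V \<inter> W)
      (oper (sections X (V \<inter> W)) (restr X V (V \<inter> W) s') (restr X W (V \<inter> W) t')))
    = germ X x U (oper (sections X U) s t)" (is "_ = ?g")
proof -
  have "germ X x (V \<inter> W)
      (oper (sections X (V \<inter> W)) (restr X V (V \<inter> W) s') (restr X W (V \<inter> W) t')) = ?g"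
    if s': "(V, s') \<in> germ X x U s" and t': "(W, t') \<in> germ X x U t" for V W s' t'
  proof -
    obtain A where A: "is_open X V" "x \<in> V" "s' \<in> carrier (sections X V)"
      "is_open X A" "x \<in> A" "A \<subseteq> U \<inter> V" "restr X U A s = restr X V A s'"
      using s' by (auto simp: germ_def)
    obtain B where B: "is_open X W" "x \<in> W" "t' \<in> carrier (sections X W)"
      "is_open X B" "x \<in> B" "B \<subseteq> U \<inter> W" "restr X U B t = restr X W B t'"
      using t' by (auto simp: germ_def)
    define C where "C = A \<inter> B"
    have C: "is_open X C" "x \<in> C" "C \<subseteq> U" "C \<subseteq> V \<inter> W" "C \<subseteq> A" "C \<subseteq> B" "C \<subseteq> V" "C \<subseteq> W"
      using A B by (auto simp: C_def)
    have VW: "is_open X (V \<inter> W)" using A B by auto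
    have "restr X U C s = restr X V C s'"
      using restr_restr[of U A C s] restr_restr[of V A C s'] A C U by auto
    moreover have "restr X U C t = restr X W C t'"
      using restr_restr[of U B C t] restr_restr[of W B C t'] B C U by auto
    ultimately show ?thesis
      using A B C U VW
      by (intro germ_eqI[of _ _ _ _ C]) (auto simp: restr closed restr_closed restr_restr)
  qed
  then show ?thesis using germ_self[OF U(1,2)] U(3,4) by (intro union_of_copies) blast+
qed

lemma germ_mult:
  assumes "is_open X U" "x \<in> U" "s \<in> carrier (sections X U)" "t \<in> carrier (sections X U)"
  shows "germ X x U s \<otimes>\<^bsub>stalk X x\<^esub> germ X x U t = germ X x U (s \<otimes>\<^bsub>sections X U\<^esub> t)"
  using germ_binop[of "\<lambda>R a b. a \<otimes>\<^bsub>R\<^esub> b", OF _ _ assms] ring_hom_mult[OF restr_hom]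
    cring.cring_simprules(5)[OF sections_cring]
  by (simp add: stalk_def)

lemma germ_add:
  assumes "is_open X U" "x \<in> U" "s \<in> carrier (sections X U)" "t \<in> carrier (sections X U)"
  shows "germ X x U s \<oplus>\<^bsub>stalk X x\<^esub> germ X x U t = germ X x U (s \<oplus>\<^bsub>sections X U\<^esub> t)"
  using germ_binop[of "\<lambda>R a b. a \<oplus>\<^bsub>R\<^esub> b", OF _ _ assms] ring_hom_add[OF restr_hom]
    cring.cring_simprules(1)[OF sections_cring]
  by (simp add: stalk_def)

lemma germ_one:
  assumes "is_open X U" "x \<in> U"
  shows "germ X x U \<one>\<^bsub>sections X U\<^esub> = \<one>\<^bsub>stalk X x\<^esub>"
proof -
  have o: "is_open X (points X)" "U \<subseteq> points X" using assms openin_subset by auto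
  have "cring (sections X (points X))" by (rule sections_cring[OF o(1)])
  then have one: "\<one>\<^bsub>sections X (points X)\<^esub> \<in> carrier (sections X (points X))"
    by (rule cring.cring_simprules(6))
  show ?thesis
    using germ_restr[OF o(1) assms o(2) one] ring_hom_one[OF restr_hom[OF o(1) assms(1) o(2)]]
    by (simp add: stalk_def)
qed

lemma germ_in_stalk:
  "\<lbrakk>is_open X U; x \<in> U; s \<in> carrier (sections X U)\<rbrakk> \<Longrightarrow> germ X x U s \<in> carrier (stalk X x)"
  by (auto simp: stalk_def)

lemma stalk_elem:
  assumes "A \<in> carrier (stalk X x)"
  obtains U s where "is_open X U" "x \<in> U" "s \<in> carrier (sections X U)" "A = germ X x U s"
  using assms by (auto simp: stalk_def)

lemma stalk_elem2:
  assumes "A \<in> carrier (stalk X x)" "B \<in> carrier (stalk X x)"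
  obtains U s t where "is_open X U" "x \<in> U" "s \<in> carrier (sections X U)"
    "t \<in> carrier (sections X U)" "A = germ X x U s" "B = germ X x U t"
proof -
  obtain V s where V: "is_open X V" "x \<in> V" "s \<in> carrier (sections X V)" "A = germ X x V s"
    using assms(1) by (rule stalk_elem)
  obtain W t where W: "is_open X W" "x \<in> W" "t \<in> carrier (sections X W)" "B = germ X x W t"
    using assms(2) by (rule stalk_elem)
  have "is_open X (V \<inter> W)" using V W by auto
  then show ?thesis
    by (intro that[of "V \<inter> W" "restr X V (V \<inter> W) s" "restr X W (V \<inter> W) t"])
      (use V W in \<open>auto simp: restr_closed germ_restr\<close>)
qed

lemma germ_hom: "\<lbrakk>is_open X U; x \<in> U\<rbrakk> \<Longrightarrow> germ X x U \<in> ring_hom (sections X U) (stalk X x)"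
  by (rule ring_hom_memI) (auto simp: germ_in_stalk germ_mult germ_add germ_one)

lemma stalk_derivation_derivation:
  assumes D: "vector_field X D" and "cring (stalk X x)"
  shows "derivation (stalk X x) (stalk_derivation X D x)"
proof -
  interpret S: cring "stalk X x" by fact
  note d = vector_field.derivation[OF D]
  note closed = derivation.closed[OF d]
  note g = stalk_derivation_germ[OF D]
  show ?thesis
  proof unfold_locales
    fix A assume "A \<in> carrier (stalk X x)"
    then obtain U s where "is_open X U" "x \<in> U" "s \<in> carrier (sections X U)" "A = germ X x U s"
      by (rule stalk_elem)
    then show "stalk_derivation X D x A \<in> carrier (stalk X x)"
      by (simp add: g closed germ_in_stalk)
  next
    fix A B assume "A \<in> carrier (stalk X x)" "B \<in> carrier (stalk X x)"
    then obtain U s t where U: "is_open X U" "x \<in> U" "s \<in> carrier (sections X U)"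
      "t \<in> carrier (sections X U)" "A = germ X x U s" "B = germ X x U t"
      by (rule stalk_elem2)
    interpret cring "sections X U" by (rule sections_cring[OF U(1)])
    show "stalk_derivation X D x (A \<oplus>\<^bsub>stalk X x\<^esub> B) =
        stalk_derivation X D x A \<oplus>\<^bsub>stalk X x\<^esub> stalk_derivation X D x B"
      using U closed[OF U(1)] by (simp add: germ_add g derivation.additive[OF d])
    show "stalk_derivation X D x (A \<otimes>\<^bsub>stalk X x\<^esub> B) =
        A \<otimes>\<^bsub>stalk X x\<^esub> stalk_derivation X D x B \<oplus>\<^bsub>stalk X x\<^esub> stalk_derivation X D x A \<otimes>\<^bsub>stalk X x\<^esub> B"
      using U closed[OF U(1)] by (simp add: germ_add germ_mult g derivation.leibniz[OF d])
  qed
qed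

text \<open>
  The set of points where a section is invertible is open, hence contains all generizations of its
  points.
\<close>

lemma vanishes_generization:
  assumes "generizes X z y" "is_open X U" "y \<in> U" "vanishes X z U s"
  shows "vanishes X y U s"
proof -
  have "z \<in> W" if "is_open X W" "y \<in> W" for W
    using assms(1) that by (auto simp: generizes_def in_closure_of)
  then show ?thesis using assms(4) unfolding vanishes_def by blast
qed

end

context locally_ringed_space
begin

text \<open>
  Elements of a local ring outside its maximal ideal are units, and an inverse of a germ, together
  with the equation that characterizes it, is defined on a neighbourhood.
\<close>

lemma vanishes_iff_germ:
  assumes U: "is_open X U" "y \<in> U" "s \<in> carrier (sections X U)"
  shows "vanishes X y U s \<longleftrightarrow> germ X y U s \<in> max_ideal (stalk X y)"
proof -
  have L: "local_ring (stalk X y)" using U stalk_local openin_subset by blast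
  interpret M: maximalideal "max_ideal (stalk X y)" "stalk X y" by (rule max_ideal_maximal[OF L])
  show ?thesis
  proof
    assume v: "vanishes X y U s"
    show "germ X y U s \<in> max_ideal (stalk X y)"
    proof (rule ccontr)
      assume "germ X y U s \<notin> max_ideal (stalk X y)"
      then obtain B where B: "B \<in> carrier (stalk X y)" "germ X y U s \<otimes>\<^bsub>stalk X y\<^esub> B = \<one>\<^bsub>stalk X y\<^esub>"
        using local_ring_unit[OF L] germ_in_stalk[OF U] by blast
      obtain V t where V: "is_open X V" "y \<in> V" "t \<in> carrier (sections X V)" "B = germ X y V t"
        using B(1) by (rule stalk_elem)
      define W where "W = U \<inter> V"
      have W: "is_open X W" "y \<in> W" "W \<subseteq> U" "W \<subseteq> V" using U V by (auto simp: W_def)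
      interpret SW: cring "sections X W" by (rule sections_cring[OF W(1)])
      define s' t' where "s' = restr X U W s" and "t' = restr X V W t"
      have st: "s' \<in> carrier (sections X W)" "t' \<in> carrier (sections X W)"
        using U V W by (auto simp: s'_def t'_def restr_closed)
      have "germ X y W (s' \<otimes>\<^bsub>sections X W\<^esub> t') = germ X y W \<one>\<^bsub>sections X W\<^esub>"
        using B U V W st by (simp add: s'_def t'_def germ_restr germ_one flip: germ_mult)
      then obtain W' where W': "is_open X W'" "y \<in> W'" "W' \<subseteq> W"
        "restr X W W' (s' \<otimes>\<^bsub>sections X W\<^esub> t') = restr X W W' \<one>\<^bsub>sections X W\<^esub>"
        using germ_eqD[OF _ W(1,2) SW.one_closed] by (metis Int_absorb)
      note h = restr_hom[OF W(1) W'(1,3)]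
      have "restr X U W' s \<otimes>\<^bsub>sections X W'\<^esub> restr X W W' t' = \<one>\<^bsub>sections X W'\<^esub>"
        using W' st ring_hom_mult[OF h] ring_hom_one[OF h] restr_restr[of U W W' s] U W
        by (simp add: s'_def)
      moreover have "restr X W W' t' \<in> carrier (sections X W')"
        using restr_closed W W' st by blast
      ultimately show False using v W' W unfolding vanishes_def by blast
    qed
  next
    assume g: "germ X y U s \<in> max_ideal (stalk X y)"
    show "vanishes X y U s"
      unfolding vanishes_def
    proof clarify
      fix W t assume W: "is_open X W" "y \<in> W" "W \<subseteq> U" "t \<in> carrier (sections X W)"
        "restr X U W s \<otimes>\<^bsub>sections X W\<^esub> t = \<one>\<^bsub>sections X W\<^esub>"
      have "germ X y U s \<otimes>\<^bsub>stalk X y\<^esub> germ X y W t = \<one>\<^bsub>stalk X y\<^esub>"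
        using germ_mult[of W y "restr X U W s" t] W U
        by (simp add: germ_restr germ_one restr_closed)
      then have "\<one>\<^bsub>stalk X y\<^esub> \<in> max_ideal (stalk X y)"
        using M.I_r_closed[OF g germ_in_stalk[OF W(1,2,4)]] by simp
      then show False using M.one_imp_carrier M.I_notcarr by blast
    qed
  qed
qed

lemma vanishes_restr:
  assumes "is_open X U" "is_open X W" "y \<in> W" "W \<subseteq> U" "s \<in> carrier (sections X U)"
  shows "vanishes X y W (restr X U W s) \<longleftrightarrow> vanishes X y U s"
  using assms by (simp add: vanishes_iff_germ restr_closed germ_restr subsetD)

lemma vanishing_sections_prime:
  assumes U: "is_open X U" "y \<in> U"
  shows "primeideal {s \<in> carrier (sections X U). vanishes X y U s} (sections X U)"
proof -
  have L: "local_ring (stalk X y)" using U stalk_local openin_subset by blast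
  then interpret S: cring "stalk X y" by (simp add: local_ring_def)
  interpret R: cring "sections X U" by (rule sections_cring[OF U(1)])
  interpret ring_hom_ring "sections X U" "stalk X y" "germ X y U"
    by (intro ring_hom_ringI2 R.ring_axioms S.ring_axioms germ_hom U)
  have "primeideal {s \<in> carrier (sections X U). germ X y U s \<in> max_ideal (stalk X y)} (sections X U)"
    by (intro primeideal_vimage R.cring_axioms S.maximalideal_prime max_ideal_maximal L)
  moreover have "{s \<in> carrier (sections X U). germ X y U s \<in> max_ideal (stalk X y)} =
      {s \<in> carrier (sections X U). vanishes X y U s}"
    using vanishes_iff_germ[OF U] by blast
  ultimately show ?thesis by simp
qed

lemma leaf_iff:
  assumes D: "vector_field X D" and y: "y \<in> points X"
  shows "leaf X D y \<longleftrightarrow> (\<forall>U s. is_open X U \<longrightarrow> y \<in> U \<longrightarrow> s \<in> carrier (sections X U) \<longrightarrow>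
    vanishes X y U s \<longrightarrow> vanishes X y U (D U s))"
proof -
  have L: "local_ring (stalk X y)" by (rule stalk_local[OF y])
  then have C: "cring (stalk X y)" by (simp add: local_ring_def)
  interpret M: maximalideal "max_ideal (stalk X y)" "stalk X y" by (rule max_ideal_maximal[OF L])
  note closed = derivation.closed[OF vector_field.derivation[OF D]]
  have "leaf X D y \<longleftrightarrow>
      (\<forall>A\<in>max_ideal (stalk X y). stalk_derivation X D y A \<in> max_ideal (stalk X y))"
    using y induced_tangent_vector_zero_iff[OF L stalk_derivation_derivation[OF D C]]
    by (auto simp: leaf_def tangent_vector_def)
  also have "\<dots> \<longleftrightarrow> (\<forall>U s. is_open X U \<longrightarrow> y \<in> U \<longrightarrow> s \<in> carrier (sections X U) \<longrightarrow>
      germ X y U s \<in> max_ideal (stalk X y) \<longrightarrow> germ X y U (D U s) \<in> max_ideal (stalk X y))"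
    (is "?l \<longleftrightarrow> ?r")
  proof
    assume ?l
    then show ?r using stalk_derivation_germ[OF D] by metis
  next
    assume r: ?r
    show ?l
    proof
      fix A assume A: "A \<in> max_ideal (stalk X y)"
      obtain U s where "is_open X U" "y \<in> U" "s \<in> carrier (sections X U)" "A = germ X y U s"
        using M.Icarr[OF A] by (rule stalk_elem)
      then show "stalk_derivation X D y A \<in> max_ideal (stalk X y)"
        using r A stalk_derivation_germ[OF D] by metis
    qed
  qed
  also have "\<dots> \<longleftrightarrow> (\<forall>U s. is_open X U \<longrightarrow> y \<in> U \<longrightarrow> s \<in> carrier (sections X U) \<longrightarrow>
    vanishes X y U s \<longrightarrow> vanishes X y U (D U s))"
    using vanishes_iff_germ closed by meson
  finally show ?thesis .
qed

end

section \<open>Sections of the spectrum of a ring\<close>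

context primeideal
begin

lemma mem_frac_iff:
  assumes "a \<in> carrier R" "s \<in> carrier R"
  shows "(b, t) \<in> frac R I a s \<longleftrightarrow> b \<in> carrier R \<and> t \<in> carrier R - I \<and>
    (\<exists>u\<in>carrier R - I. u \<otimes> (a \<otimes> t) = u \<otimes> (b \<otimes> s))"
proof -
  have "u \<otimes> (x \<ominus> y) = \<zero> \<longleftrightarrow> u \<otimes> x = u \<otimes> y"
    if "u \<in> carrier R" "x \<in> carrier R" "y \<in> carrier R" for u x y
  proof -
    have "u \<otimes> (x \<ominus> y) = u \<otimes> x \<ominus> u \<otimes> y" using that by (simp add: minus_eq r_distr r_minus)
    then show ?thesis using that by simp
  qed
  then show ?thesis using assms by (auto simp: frac_def)
qed

lemma mult_not_mem:
  "\<lbrakk>u \<in> carrier R - I; w \<in> carrier R - I\<rbrakk> \<Longrightarrow> u \<otimes> w \<in> carrier R - I"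
  using I_prime by auto

lemma one_not_mem: "\<one> \<in> carrier R - I"
  using one_imp_carrier I_notcarr by auto

lemma frac_self: "\<lbrakk>a \<in> carrier R; s \<in> carrier R - I\<rbrakk> \<Longrightarrow> (a, s) \<in> frac R I a s"
  using one_not_mem by (subst mem_frac_iff) auto

lemma frac_eqI:
  assumes "a \<in> carrier R" "s \<in> carrier R - I" "b \<in> carrier R" "t \<in> carrier R - I"
    and "u \<in> carrier R - I" "u \<otimes> (a \<otimes> t) = u \<otimes> (b \<otimes> s)"
  shows "frac R I a s = frac R I b t"
proof -
  have "frac R I a s \<subseteq> frac R I b t"
    if asm: "a \<in> carrier R" "s \<in> carrier R - I" "b \<in> carrier R" "t \<in> carrier R - I"
      "u \<in> carrier R - I" "u \<otimes> (a \<otimes> t) = u \<otimes> (b \<otimes> s)" for a s b t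
  proof clarify
    fix c v assume "(c, v) \<in> frac R I a s"
    then obtain w where w: "c \<in> carrier R" "v \<in> carrier R - I" "w \<in> carrier R - I"
      "w \<otimes> (a \<otimes> v) = w \<otimes> (c \<otimes> s)"
      using asm by (auto simp: mem_frac_iff)
    have c: "a \<in> carrier R" "s \<in> carrier R" "b \<in> carrier R" "t \<in> carrier R" "u \<in> carrier R"
      "c \<in> carrier R" "v \<in> carrier R" "w \<in> carrier R"
      using asm w by auto
    \<comment> \<open>Transitivity of the equivalence of fractions; the witness has to absorb the middle denominator.\<close>
    have "(u \<otimes> w \<otimes> s) \<otimes> (b \<otimes> v) = (w \<otimes> v) \<otimes> (u \<otimes> (b \<otimes> s))" using c by (simp add: m_ac)
    also have "\<dots> = (u \<otimes> t) \<otimes> (w \<otimes> (a \<otimes> v))"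
      unfolding asm(6)[symmetric] using c by (simp add: m_ac)
    also have "\<dots> = (u \<otimes> w \<otimes> s) \<otimes> (c \<otimes> t)"
      unfolding w(4) using c by (simp add: m_ac)
    finally show "(c, v) \<in> frac R I b t"
      using asm w mult_not_mem by (subst mem_frac_iff) (auto intro!: bexI[of _ "u \<otimes> w \<otimes> s"])
  qed
  from this[of a s b t] this[of b t a s] show ?thesis using assms by auto
qed

lemma frac_mult:
  assumes a: "a \<in> carrier R" "s \<in> carrier R - I" and b: "b \<in> carrier R" "t \<in> carrier R - I"
  shows "frac R I a s \<otimes>\<^bsub>localization R I\<^esub> frac R I b t = frac R I (a \<otimes> b) (s \<otimes> t)"
  unfolding localization_def monoid.simps
proof (rule union_of_copies)
  fix a' s' b' t' assume "(a', s') \<in> frac R I a s" "(b', t') \<in> frac R I b t"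
  then obtain u w where u: "a' \<in> carrier R" "s' \<in> carrier R - I" "u \<in> carrier R - I"
    "u \<otimes> (a \<otimes> s') = u \<otimes> (a' \<otimes> s)"
    and w: "b' \<in> carrier R" "t' \<in> carrier R - I" "w \<in> carrier R - I"
    "w \<otimes> (b \<otimes> t') = w \<otimes> (b' \<otimes> t)"
    using a b by (auto simp: mem_frac_iff)
  have c: "a \<in> carrier R" "s \<in> carrier R" "b \<in> carrier R" "t \<in> carrier R" "u \<in> carrier R"
    "a' \<in> carrier R" "s' \<in> carrier R" "b' \<in> carrier R" "t' \<in> carrier R" "w \<in> carrier R"
    using a b u w by auto
  have "(u \<otimes> w) \<otimes> ((a' \<otimes> b') \<otimes> (s \<otimes> t)) = (u \<otimes> (a' \<otimes> s)) \<otimes> (w \<otimes> (b' \<otimes> t))"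
    using c by (simp add: m_ac)
  also have "\<dots> = (u \<otimes> w) \<otimes> ((a \<otimes> b) \<otimes> (s' \<otimes> t'))"
    unfolding u(4)[symmetric] w(4)[symmetric] using c by (simp add: m_ac)
  finally show "frac R I (a' \<otimes> b') (s' \<otimes> t') = frac R I (a \<otimes> b) (s \<otimes> t)"
    using a b u w mult_not_mem by (intro frac_eqI[of _ _ _ _ "u \<otimes> w"]) auto
qed (use frac_self a b in blast)+

lemma frac_add:
  assumes a: "a \<in> carrier R" "s \<in> carrier R - I" and b: "b \<in> carrier R" "t \<in> carrier R - I"
  shows "frac R I a s \<oplus>\<^bsub>localization R I\<^esub> frac R I b t =
    frac R I (a \<otimes> t \<oplus> b \<otimes> s) (s \<otimes> t)"
  unfolding localization_def ring.simps
proof (rule union_of_copies)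
  fix a' s' b' t' assume "(a', s') \<in> frac R I a s" "(b', t') \<in> frac R I b t"
  then obtain u w where u: "a' \<in> carrier R" "s' \<in> carrier R - I" "u \<in> carrier R - I"
    "u \<otimes> (a \<otimes> s') = u \<otimes> (a' \<otimes> s)"
    and w: "b' \<in> carrier R" "t' \<in> carrier R - I" "w \<in> carrier R - I"
    "w \<otimes> (b \<otimes> t') = w \<otimes> (b' \<otimes> t)"
    using a b by (auto simp: mem_frac_iff)
  have c: "a \<in> carrier R" "s \<in> carrier R" "b \<in> carrier R" "t \<in> carrier R" "u \<in> carrier R"
    "a' \<in> carrier R" "s' \<in> carrier R" "b' \<in> carrier R" "t' \<in> carrier R" "w \<in> carrier R"
    using a b u w by auto
  have "(u \<otimes> w) \<otimes> ((a' \<otimes> t' \<oplus> b' \<otimes> s') \<otimes> (s \<otimes> t)) =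
      (u \<otimes> (a' \<otimes> s)) \<otimes> (w \<otimes> t \<otimes> t') \<oplus> (w \<otimes> (b' \<otimes> t)) \<otimes> (u \<otimes> s \<otimes> s')"
    using c by (simp add: m_ac l_distr r_distr)
  also have "\<dots> = (u \<otimes> w) \<otimes> ((a \<otimes> t \<oplus> b \<otimes> s) \<otimes> (s' \<otimes> t'))"
    unfolding u(4)[symmetric] w(4)[symmetric] using c by (simp add: m_ac l_distr r_distr)
  finally show "frac R I (a' \<otimes> t' \<oplus> b' \<otimes> s') (s' \<otimes> t') = frac R I (a \<otimes> t \<oplus> b \<otimes> s) (s \<otimes> t)"
    using a b u w mult_not_mem by (intro frac_eqI[of _ _ _ _ "u \<otimes> w"]) auto
qed (use frac_self a b in blast)+

lemma frac_cancel:
  assumes "a \<in> carrier R" "t \<in> carrier R - I"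
  shows "frac R I (t \<otimes> a) (\<one> \<otimes> t) = frac R I a \<one>"
  using assms one_not_mem by (intro frac_eqI[of _ _ _ _ \<one>]) (auto simp: m_ac)

end

lemma points_Spec: 
  assumes "cring R" shows "points (Spec R) = {P. primeideal P R}"
proof
  show "points (Spec R) \<subseteq> {P. primeideal P R}"
    using openin_topspace[of "zariski R"] unfolding Spec_def openin_zariski by auto
  have "openin (zariski R) {P. primeideal P R}"
    unfolding openin_zariski
  proof (intro exI[of _ "carrier R"] conjI)
    show "{P. primeideal P R} = {P. primeideal P R \<and> \<not> carrier R \<subseteq> P}"
      using primeideal.I_notcarr additive_subgroup.a_subset[OF ideal.axioms(1)[OF primeideal.axioms(1)]]
      by blast
  qed simp
  then show "{P. primeideal P R} \<subseteq> points (Spec R)"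
    using openin_subset by (auto simp: Spec_def)
qed

lemma open_Spec_prime: "\<lbrakk>is_open (Spec R) U; P \<in> U\<rbrakk> \<Longrightarrow> primeideal P R"
  by (auto simp: Spec_def openin_zariski)

lemma open_nonvanishing: "r \<in> carrier R \<Longrightarrow> is_open (Spec R) {P. primeideal P R \<and> r \<notin> P}"
  by (auto simp: Spec_def openin_zariski intro!: exI[of _ "{r}"])

text \<open>
  The section \<open>a/s\<close> of the structure sheaf of \<open>Spec R\<close>; it is meant for open sets \<open>U\<close> on which \<open>s\<close>
  has no zero. The sections \<open>r/1\<close> over the whole spectrum are the elements of \<open>R\<close> seen as functions.
\<close>

definition fraction_section ::
  "('a, 'm) ring_scheme \<Rightarrow> 'a set set \<Rightarrow> 'a \<Rightarrow> 'a \<Rightarrow> 'a set \<Rightarrow> ('a \<times> 'a) set" where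
  "fraction_section R U a s = (\<lambda>P\<in>U. frac R P a s)"

lemma restr_fraction_section:
  "V \<subseteq> U \<Longrightarrow> restr (Spec R) U V (fraction_section R U a s) = fraction_section R V a s"
  by (auto simp: Spec_def fraction_section_def Int_absorb1 fun_eq_iff)

lemma fraction_section_closed:
  assumes "is_open (Spec R) U" "a \<in> carrier R" "s \<in> carrier R" "\<And>P. P \<in> U \<Longrightarrow> s \<notin> P"
  shows "fraction_section R U a s \<in> carrier (sections (Spec R) U)"
proof -
  have "\<exists>b\<in>carrier R. \<exists>t\<in>carrier R. \<forall>Q\<in>U. t \<notin> Q \<and> fraction_section R U a s Q = frac R Q b t"
    by (rule bexI[of _ a], rule bexI[of _ s]) (use assms in \<open>auto simp: fraction_section_def\<close>)
  moreover have "fraction_section R U a s \<in> (\<Pi>\<^sub>E P\<in>U. carrier (localization R P))"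
    using assms by (auto simp: fraction_section_def localization_def)
  ultimately show ?thesis
    using assms(1) by (auto simp: Spec_def spec_sections_def)
qed

lemma fraction_section_mult:
  assumes U: "is_open (Spec R) U" and s: "s \<in> carrier R" "\<And>P. P \<in> U \<Longrightarrow> s \<notin> P"
    and t: "t \<in> carrier R" "\<And>P. P \<in> U \<Longrightarrow> t \<notin> P" and ab: "a \<in> carrier R" "b \<in> carrier R"
  shows "fraction_section R U a s \<otimes>\<^bsub>sections (Spec R) U\<^esub> fraction_section R U b t =
    fraction_section R U (a \<otimes>\<^bsub>R\<^esub> b) (s \<otimes>\<^bsub>R\<^esub> t)"
  using assms primeideal.frac_mult[OF open_Spec_prime[OF U]]
  by (auto simp: Spec_def spec_sections_def fraction_section_def fun_eq_iff)

lemma fraction_section_add: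
  assumes U: "is_open (Spec R) U" and s: "s \<in> carrier R" "\<And>P. P \<in> U \<Longrightarrow> s \<notin> P"
    and t: "t \<in> carrier R" "\<And>P. P \<in> U \<Longrightarrow> t \<notin> P" and ab: "a \<in> carrier R" "b \<in> carrier R"
  shows "fraction_section R U a s \<oplus>\<^bsub>sections (Spec R) U\<^esub> fraction_section R U b t =
    fraction_section R U (a \<otimes>\<^bsub>R\<^esub> t \<oplus>\<^bsub>R\<^esub> b \<otimes>\<^bsub>R\<^esub> s) (s \<otimes>\<^bsub>R\<^esub> t)"
  using assms primeideal.frac_add[OF open_Spec_prime[OF U]]
  by (auto simp: Spec_def spec_sections_def fraction_section_def fun_eq_iff)

lemma fraction_section_one:
  "fraction_section R U \<one>\<^bsub>R\<^esub> \<one>\<^bsub>R\<^esub> = \<one>\<^bsub>sections (Spec R) U\<^esub>"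
  by (simp add: Spec_def spec_sections_def fraction_section_def localization_def)

lemma fraction_section_hom:
  assumes R: "cring R" and U: "is_open (Spec R) U"
  shows "(\<lambda>r. fraction_section R U r \<one>\<^bsub>R\<^esub>) \<in> ring_hom R (sections (Spec R) U)"
proof -
  interpret cring R by (rule R)
  have one: "\<one>\<^bsub>R\<^esub> \<notin> P" if "P \<in> U" for P
    using primeideal.one_not_mem[OF open_Spec_prime[OF U that]] by simp
  show ?thesis
    by (rule ring_hom_memI)
      (use one U in \<open>simp_all add: fraction_section_closed fraction_section_mult
        fraction_section_add fraction_section_one\<close>)
qed

text \<open>
  Away from its zeros \<open>r/1\<close> has the inverse \<open>1/r\<close>. Conversely, an inverse \<open>b/t\<close> of \<open>r/1\<close> in the
  localization at \<open>P\<close> gives an equation \<open>u r b = u t\<close> with \<open>u t \<notin> P\<close>.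
\<close>

lemma vanishes_fraction_section_iff:
  assumes R: "cring R" and U: "is_open (Spec R) U" "P \<in> U" and r: "r \<in> carrier R"
  shows "vanishes (Spec R) P U (fraction_section R U r \<one>\<^bsub>R\<^esub>) \<longleftrightarrow> r \<in> P"
proof -
  interpret cring R by (rule R)
  interpret P: primeideal P R by (rule open_Spec_prime[OF U])
  show ?thesis
  proof
    assume v: "vanishes (Spec R) P U (fraction_section R U r \<one>\<^bsub>R\<^esub>)"
    show "r \<in> P"
    proof (rule ccontr)
      assume "r \<notin> P"
      define W where "W = U \<inter> {Q. primeideal Q R \<and> r \<notin> Q}"
      have W: "is_open (Spec R) W" "P \<in> W" "W \<subseteq> U" "\<And>Q. Q \<in> W \<Longrightarrow> r \<notin> Q"
        using U open_nonvanishing[OF r] \<open>r \<notin> P\<close> P.primeideal by (auto simp: W_def)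
      have one: "\<one>\<^bsub>R\<^esub> \<notin> Q" if "Q \<in> W" for Q
        using primeideal.one_not_mem[OF open_Spec_prime[OF W(1) that]] by simp
      have "frac R Q (r \<otimes>\<^bsub>R\<^esub> \<one>\<^bsub>R\<^esub>) (\<one>\<^bsub>R\<^esub> \<otimes>\<^bsub>R\<^esub> r) = frac R Q \<one>\<^bsub>R\<^esub> \<one>\<^bsub>R\<^esub>" if "Q \<in> W" for Q
        using primeideal.frac_cancel[OF open_Spec_prime[OF W(1) that]] W(4) r that by blast
      then have "restr (Spec R) U W (fraction_section R U r \<one>\<^bsub>R\<^esub>)
          \<otimes>\<^bsub>sections (Spec R) W\<^esub> fraction_section R W \<one>\<^bsub>R\<^esub> r = fraction_section R W \<one>\<^bsub>R\<^esub> \<one>\<^bsub>R\<^esub>"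
        using W one r
        by (simp add: restr_fraction_section fraction_section_mult)
          (auto simp: fraction_section_def fun_eq_iff)
      moreover have "fraction_section R W \<one>\<^bsub>R\<^esub> r \<in> carrier (sections (Spec R) W)"
        using W r by (intro fraction_section_closed) auto
      ultimately show False
        using v W unfolding vanishes_def fraction_section_one by blast
    qed
  next
    assume rP: "r \<in> P"
    show "vanishes (Spec R) P U (fraction_section R U r \<one>\<^bsub>R\<^esub>)"
      unfolding vanishes_def
    proof clarify
      fix W \<tau> assume W: "is_open (Spec R) W" "P \<in> W" "W \<subseteq> U" "\<tau> \<in> carrier (sections (Spec R) W)"
        "restr (Spec R) U W (fraction_section R U r \<one>\<^bsub>R\<^esub>) \<otimes>\<^bsub>sections (Spec R) W\<^esub> \<tau> =
          \<one>\<^bsub>sections (Spec R) W\<^esub>"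
      obtain b t where bt: "b \<in> carrier R" "t \<in> carrier R" "t \<notin> P" "\<tau> P = frac R P b t"
        using W(2,4) by (fastforce simp: Spec_def spec_sections_def)
      have "frac R P r \<one>\<^bsub>R\<^esub> \<otimes>\<^bsub>localization R P\<^esub> \<tau> P = frac R P \<one>\<^bsub>R\<^esub> \<one>\<^bsub>R\<^esub>"
        using fun_cong[OF W(5), of P] W(2,3)
        by (auto simp: restr_fraction_section)
          (auto simp: Spec_def spec_sections_def fraction_section_def localization_def)
      then have "frac R P (r \<otimes>\<^bsub>R\<^esub> b) (\<one>\<^bsub>R\<^esub> \<otimes>\<^bsub>R\<^esub> t) = frac R P \<one>\<^bsub>R\<^esub> \<one>\<^bsub>R\<^esub>"
        using P.frac_mult r bt P.one_not_mem by simp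
      then have "(\<one>\<^bsub>R\<^esub>, \<one>\<^bsub>R\<^esub>) \<in> frac R P (r \<otimes>\<^bsub>R\<^esub> b) (\<one>\<^bsub>R\<^esub> \<otimes>\<^bsub>R\<^esub> t)"
        using P.frac_self P.one_not_mem by simp
      then obtain u where u: "u \<in> carrier R - P" "u \<otimes>\<^bsub>R\<^esub> (r \<otimes>\<^bsub>R\<^esub> b) = u \<otimes>\<^bsub>R\<^esub> t"
        using r bt by (auto simp: P.mem_frac_iff)
      have "r \<otimes>\<^bsub>R\<^esub> b \<in> P" using rP bt(1) by (rule P.I_r_closed)
      then have "u \<otimes>\<^bsub>R\<^esub> t \<in> P" using u P.I_l_closed[of "r \<otimes>\<^bsub>R\<^esub> b" u] by simp
      then show False using u bt P.I_prime by auto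
    qed
  qed
qed

text \<open>
  Clearing denominators: the equation \<open>t \<sigma> = a\<close> is how local fractions are used later, as apart
  from \<open>\<sigma>\<close> it involves only sections that come from \<open>R\<close>.
\<close>

lemma spec_section_locally_fraction:
  assumes "\<sigma> \<in> carrier (sections (Spec R) U)" "P \<in> U"
  obtains V a t where "is_open (Spec R) V" "P \<in> V" "V \<subseteq> U" "a \<in> carrier R" "t \<in> carrier R" "t \<notin> P"
    "fraction_section R V t \<one>\<^bsub>R\<^esub> \<otimes>\<^bsub>sections (Spec R) V\<^esub> restr (Spec R) U V \<sigma> =
      fraction_section R V a \<one>\<^bsub>R\<^esub>"
proof -
  have "\<exists>V. openin (zariski R) V \<and> P \<in> V \<and> V \<subseteq> U \<and>
      (\<exists>a\<in>carrier R. \<exists>t\<in>carrier R. \<forall>Q\<in>V. t \<notin> Q \<and> \<sigma> Q = frac R Q a t)"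
    using assms by (simp add: Spec_def spec_sections_def)
  then obtain V where V: "is_open (Spec R) V" "P \<in> V" "V \<subseteq> U"
    and fraction: "\<exists>a\<in>carrier R. \<exists>t\<in>carrier R. \<forall>Q\<in>V. t \<notin> Q \<and> \<sigma> Q = frac R Q a t"
    by (auto simp: Spec_def)
  obtain a t where at: "a \<in> carrier R" "t \<in> carrier R"
    and \<sigma>: "\<forall>Q\<in>V. t \<notin> Q \<and> \<sigma> Q = frac R Q a t"
    using fraction by (elim bexE)
  have eq: "restr (Spec R) U V \<sigma> = fraction_section R V a t"
    using \<sigma> by (auto simp: Spec_def fraction_section_def fun_eq_iff)
  have "frac R Q t \<one>\<^bsub>R\<^esub> \<otimes>\<^bsub>localization R Q\<^esub> frac R Q a t = frac R Q a \<one>\<^bsub>R\<^esub>" if Q: "Q \<in> V" for Q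
  proof -
    interpret Q: primeideal Q R by (rule open_Spec_prime[OF V(1) Q])
    show ?thesis
      using V at bspec[OF \<sigma> Q] Q.frac_mult[of t "\<one>\<^bsub>R\<^esub>" a t] Q.frac_cancel[of a t] Q.one_not_mem by simp
  qed
  then have "fraction_section R V t \<one>\<^bsub>R\<^esub> \<otimes>\<^bsub>sections (Spec R) V\<^esub> restr (Spec R) U V \<sigma> =
      fraction_section R V a \<one>\<^bsub>R\<^esub>"
    unfolding eq by (auto simp: Spec_def spec_sections_def fraction_section_def fun_eq_iff)
  then show ?thesis using that[OF V at] V(2) \<sigma> by blast
qed

section \<open>Morphisms and affine charts\<close>

context lrs_morphism
begin

lemma preimage_open: "is_open Y V \<Longrightarrow> is_open X (preimage X f V)"
  unfolding preimage_def by (rule openin_continuous_map_preimage[OF continuous])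

lemma pullback_closed:
  "\<lbrakk>is_open Y V; s \<in> carrier (sections Y V)\<rbrakk> \<Longrightarrow> \<phi> V s \<in> carrier (sections X (preimage X f V))"
  using hom ring_hom_closed by metis

lemma stalk_map_germ:
  assumes y: "y \<in> points X" and V: "is_open Y V" "f y \<in> V" "s \<in> carrier (sections Y V)"
  shows "stalk_map X f \<phi> y (germ Y (f y) V s) = germ X y (preimage X f V) (\<phi> V s)"
proof -
  have "germ X y (preimage X f V') (\<phi> V' t) = germ X y (preimage X f V) (\<phi> V s)"
    if "(V', t) \<in> germ Y (f y) V s" for V' t
  proof -
    obtain W where W: "is_open Y V'" "f y \<in> V'" "t \<in> carrier (sections Y V')"
      "is_open Y W" "f y \<in> W" "W \<subseteq> V" "W \<subseteq> V'" "restr Y V W s = restr Y V' W t"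
      using \<open>(V', t) \<in> germ Y (f y) V s\<close> by (auto simp: germ_def)
    show ?thesis
    proof (rule X.germ_eqI[where W = "preimage X f W"])
      show "restr X (preimage X f V') (preimage X f W) (\<phi> V' t) =
          restr X (preimage X f V) (preimage X f W) (\<phi> V s)"
        using V W by (simp add: natural)
      show "preimage X f W \<subseteq> preimage X f V' \<inter> preimage X f V"
        using W by (auto simp: preimage_def)
      show "y \<in> preimage X f W" using W y by (simp add: preimage_def)
    qed (use V W in \<open>auto simp: preimage_open pullback_closed\<close>)
  qed
  then show ?thesis
    unfolding stalk_map_def using Y.germ_self[OF V] by blast
qed

text \<open>
  Inverses can be pulled back, so the pullback of an invertible section is invertible; the other
  direction is the locality of the maps between stalks.
\<close>

lemma vanishes_pullback_iff:
  assumes y: "y \<in> points X" and V: "is_open Y V" "f y \<in> V" "s \<in> carrier (sections Y V)"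
  shows "vanishes X y (preimage X f V) (\<phi> V s) \<longleftrightarrow> vanishes Y (f y) V s"
proof
  have y': "y \<in> preimage X f V" using y V by (simp add: preimage_def)
  show "vanishes X y (preimage X f V) (\<phi> V s)" if "vanishes Y (f y) V s"
  proof -
    have "germ Y (f y) V s \<in> max_ideal (stalk Y (f y))"
      using that V by (simp add: Y.vanishes_iff_germ)
    then show ?thesis
      using local[OF y] V y y'
      by (simp add: X.vanishes_iff_germ preimage_open pullback_closed flip: stalk_map_germ)
  qed
  show "vanishes Y (f y) V s" if v: "vanishes X y (preimage X f V) (\<phi> V s)"
  proof (rule ccontr)
    assume "\<not> vanishes Y (f y) V s"
    then obtain W t where W: "is_open Y W" "f y \<in> W" "W \<subseteq> V" "t \<in> carrier (sections Y W)"
      "restr Y V W s \<otimes>\<^bsub>sections Y W\<^esub> t = \<one>\<^bsub>sections Y W\<^esub>"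
      unfolding vanishes_def by blast
    let ?S = "sections X (preimage X f W)"
    have "restr X (preimage X f V) (preimage X f W) (\<phi> V s) \<otimes>\<^bsub>?S\<^esub> \<phi> W t = \<one>\<^bsub>?S\<^esub>"
      using W V ring_hom_mult[OF hom[OF W(1)], of "restr Y V W s" t] ring_hom_one[OF hom[OF W(1)]]
      by (simp add: natural Y.restr_closed)
    moreover have "\<phi> W t \<in> carrier ?S" "is_open X (preimage X f W)" "y \<in> preimage X f W"
      "preimage X f W \<subseteq> preimage X f V"
      using W y pullback_closed preimage_open by (auto simp: preimage_def)
    ultimately show False using v unfolding vanishes_def by blast
  qed
qed

end

lemma ring_hom_nat_multiple_one:
  assumes "ring R" "ring S" "h \<in> ring_hom R S"
  shows "h (add_pow R (n::nat) \<one>\<^bsub>R\<^esub>) = add_pow S n \<one>\<^bsub>S\<^esub>"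
proof -
  interpret ring_hom_ring R S h by (intro ring_hom_ringI2 assms)
  show ?thesis by (induction n) (simp_all add: R.add.nat_pow_Suc S.add.nat_pow_Suc)
qed

lemma add_pow_rat_ring: "add_pow rat_ring (n::nat) \<one>\<^bsub>rat_ring\<^esub> = of_nat n"
proof (induction n)
  case 0
  then show ?case by (simp add: add_pow_def nat_pow_def rat_ring_def)
next
  case (Suc n)
  then show ?case by (simp add: add_pow_def nat_pow_def rat_ring_def)
qed

text \<open>
  Residue fields of a scheme over the rationals have characteristic zero: the multiple \<open>c \<cdot> 1\<close> is the
  pullback of the rational number \<open>c\<close>, which lies in no prime ideal of the rationals.
\<close>

lemma (in scheme_over_rat) nat_multiple_nonvanishing:
  assumes U: "is_open X U" "y \<in> U" and c: "c > 0"
  shows "\<not> vanishes X y U (add_pow (sections X U) (c::nat) \<one>\<^bsub>sections X U\<^esub>)"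
proof -
  let ?Y = "Spec rat_ring"
  let ?P = "points ?Y"
  have y: "y \<in> points X" "U \<subseteq> points X" using U openin_subset by auto
  have P: "is_open ?Y ?P" by simp
  have fy: "f y \<in> ?P"
    using y(1) structure_morphism.continuous by (auto simp: continuous_map_def)
  interpret I: primeideal "f y" rat_ring by (rule open_Spec_prime[OF P fy])
  let ?q = "of_nat c :: rat"
  have "?q \<notin> f y"
  proof
    assume "?q \<in> f y"
    then have "1 / ?q * ?q \<in> f y"
      using I.I_l_closed[of ?q "1 / ?q"] by (simp add: rat_ring_def)
    then show False using c I.one_not_mem by (simp add: rat_ring_def)
  qed
  then have "\<not> vanishes ?Y (f y) ?P (fraction_section rat_ring ?P ?q \<one>\<^bsub>rat_ring\<^esub>)"
    using vanishes_fraction_section_iff[OF I.is_cring P fy, of ?q] by (simp add: rat_ring_def)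
  moreover have "fraction_section rat_ring ?P ?q \<one>\<^bsub>rat_ring\<^esub> =
      add_pow (sections ?Y ?P) c \<one>\<^bsub>sections ?Y ?P\<^esub>"
    using ring_hom_nat_multiple_one[OF I.ring_axioms _ fraction_section_hom[OF I.is_cring P], of c]
      structure_morphism.Y.sections_cring[OF P]
    by (simp add: add_pow_rat_ring cring_def)
  moreover have "add_pow (sections ?Y ?P) c \<one>\<^bsub>sections ?Y ?P\<^esub> \<in> carrier (sections ?Y ?P)"
  proof -
    interpret cring "sections ?Y ?P" by (rule structure_morphism.Y.sections_cring[OF P])
    show ?thesis by simp
  qed
  ultimately have "\<not> vanishes X y (preimage X f ?P)
      (\<phi> ?P (add_pow (sections ?Y ?P) c \<one>\<^bsub>sections ?Y ?P\<^esub>))"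
    using structure_morphism.vanishes_pullback_iff[OF y(1) P fy] by simp
  moreover have pre: "preimage X f ?P = points X"
    using structure_morphism.continuous by (auto simp: preimage_def continuous_map_def)
  moreover have "\<phi> ?P (add_pow (sections ?Y ?P) c \<one>\<^bsub>sections ?Y ?P\<^esub>) =
      add_pow (sections X (points X)) c \<one>\<^bsub>sections X (points X)\<^esub>"
    using ring_hom_nat_multiple_one[OF _ _ structure_morphism.hom[OF P], of c] pre
      structure_morphism.Y.sections_cring[OF P] sections_cring[of "points X"]
    by (simp add: cring_def)
  ultimately have nv: "\<not> vanishes X y (points X) (add_pow (sections X (points X)) c \<one>\<^bsub>sections X (points X)\<^esub>)"
    by simp
  interpret S: cring "sections X (points X)" by (rule sections_cring) simp
  interpret SU: cring "sections X U" by (rule sections_cring[OF U(1)])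
  have "restr X (points X) U (add_pow (sections X (points X)) c \<one>\<^bsub>sections X (points X)\<^esub>) =
      add_pow (sections X U) c \<one>\<^bsub>sections X U\<^esub>"
    using y U by (intro ring_hom_nat_multiple_one S.ring_axioms SU.ring_axioms restr_hom) auto
  then show ?thesis
    using nv vanishes_restr[of "points X" U y "add_pow (sections X (points X)) c \<one>\<^bsub>sections X (points X)\<^esub>"] U y
    by simp
qed

text \<open>
  An affine open set \<open>U\<close>, described through a coordinate ring \<open>R\<close> mapped into the sections over \<open>U\<close>.
  The homeomorphism with \<open>Spec R\<close> is encoded by vanishing alone: the point of \<open>Spec R\<close> that
  corresponds to \<open>y\<close> is the set of all \<open>r\<close> such that \<open>h r\<close> vanishes at \<open>y\<close>.
\<close>

locale affine_chart =
  fixes X :: "('a, 'b) ringed_space" and U :: "'a set" and R :: "'c ring" and h :: "'c \<Rightarrow> 'b"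
  assumes chart_open: "is_open X U"
    and coordinate_cring: "cring R"
    and coordinate_hom: "h \<in> ring_hom R (sections X U)"
    and point_of_prime: "primeideal P R \<Longrightarrow> \<exists>y\<in>U. \<forall>r\<in>carrier R. vanishes X y U (h r) \<longleftrightarrow> r \<in> P"
    and generizesI: "\<lbrakk>z \<in> U; y \<in> U; \<And>r. \<lbrakk>r \<in> carrier R; vanishes X z U (h r)\<rbrakk> \<Longrightarrow> vanishes X y U (h r)\<rbrakk>
      \<Longrightarrow> generizes X z y"
    and locally_fraction: "\<lbrakk>is_open X V; V \<subseteq> U; y \<in> V; s \<in> carrier (sections X V)\<rbrakk> \<Longrightarrow>
      \<exists>W a t. is_open X W \<and> y \<in> W \<and> W \<subseteq> V \<and> a \<in> carrier R \<and> t \<in> carrier R \<and>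
        \<not> vanishes X y U (h t) \<and>
        restr X U W (h t) \<otimes>\<^bsub>sections X W\<^esub> restr X V W s = restr X U W (h a)"

lemma affine_chart_of_isomorphism:
  fixes X :: "('a, 'b) ringed_space" and R :: "'c ring"
  assumes U: "is_open X U" and R: "cring R"
    and iso: "lrs_isomorphism (open_subspace X U) (Spec R) f \<phi>"
  shows "affine_chart X U R (\<lambda>r. \<phi> (points (Spec R)) (fraction_section R (points (Spec R)) r \<one>\<^bsub>R\<^esub>))"
proof -
  let ?X = "open_subspace X U" and ?Y = "Spec R"
  let ?P = "points ?Y"
  let ?h = "\<lambda>r. \<phi> ?P (fraction_section R ?P r \<one>\<^bsub>R\<^esub>)"
  interpret I: lrs_isomorphism ?X ?Y f \<phi> by (rule iso)
  interpret cring R by (rule R)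
  have UX: "U \<subseteq> points X" using U openin_subset by auto
  have open_iff: "is_open ?X W \<longleftrightarrow> is_open X W \<and> W \<subseteq> U" for W
    using U by (simp add: open_subspace_def openin_open_subtopology)
  have pts: "points ?X = U" using UX by (auto simp: open_subspace_def)
  have [simp]: "sections ?X = sections X" "restr ?X = restr X" by (auto simp: open_subspace_def)
  have vanishes_eq: "vanishes ?X y W s \<longleftrightarrow> vanishes X y W s" if "W \<subseteq> U" for y W s
    using that by (auto simp: vanishes_def open_iff)
  have P: "is_open ?Y ?P" by simp
  have fP: "f y \<in> ?P" if "y \<in> U" for y
    using that I.continuous pts by (auto simp: continuous_map_def)
  have pre: "preimage ?X f ?P = U"
    using fP pts by (auto simp: preimage_def)
  have inj: "inj_on f U"
    using homeomorphic_imp_injective_map[OF I.homeomorphic] pts by simp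
  have open_image: "is_open ?Y (f ` W)" if "is_open X W" "W \<subseteq> U" for W
    using homeomorphic_imp_open_map[OF I.homeomorphic] that open_iff by (auto simp: open_map_def)
  have one: "\<one>\<^bsub>R\<^esub> \<notin> Q" if "Q \<in> ?P" for Q
    using primeideal.one_not_mem[OF open_Spec_prime[OF P that]] by simp
  have const: "fraction_section R ?P r \<one>\<^bsub>R\<^esub> \<in> carrier (sections ?Y ?P)" if "r \<in> carrier R" for r
    using that one by (intro fraction_section_closed[OF P]) auto
  have van: "vanishes X y U (?h r) \<longleftrightarrow> r \<in> f y" if "y \<in> U" "r \<in> carrier R" for y r
    using I.vanishes_pullback_iff[OF _ P fP const, of y r] that pts
      vanishes_fraction_section_iff[OF R P fP, of y r]
    by (simp add: pre vanishes_eq)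
  show ?thesis
  proof
    show "is_open X U" by (rule U)
    have "\<phi> ?P \<in> ring_hom (sections ?Y ?P) (sections X U)" using I.hom[OF P] pre by simp
    then show "?h \<in> ring_hom R (sections X U)"
      using ring_hom_trans[OF fraction_section_hom[OF R P]] by (simp add: comp_def)
    show "\<exists>y\<in>U. \<forall>r\<in>carrier R. vanishes X y U (?h r) \<longleftrightarrow> r \<in> Q" if "primeideal Q R" for Q
    proof -
      have "Q \<in> f ` U"
        using homeomorphic_imp_surjective_map[OF I.homeomorphic] pts that points_Spec[OF R] by auto
      then show ?thesis using van by blast
    qed
  next
    fix z y assume zy: "z \<in> U" "y \<in> U"
      and sub: "\<And>r. \<lbrakk>r \<in> carrier R; vanishes X z U (?h r)\<rbrakk> \<Longrightarrow> vanishes X y U (?h r)"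
    \<comment> \<open>An inclusion between primes is a specialization in the Zariski topology.\<close>
    have "z \<in> T" if T: "is_open X T" "y \<in> T" for T
    proof -
      have "is_open ?Y (f ` (T \<inter> U))" using T U by (intro open_image) auto
      then obtain S where S: "S \<subseteq> carrier R" "f ` (T \<inter> U) = {Q. primeideal Q R \<and> \<not> S \<subseteq> Q}"
        by (auto simp: Spec_def openin_zariski)
      have "f y \<in> f ` (T \<inter> U)" using T zy by simp
      then obtain r where r: "r \<in> S" "r \<notin> f y" unfolding S(2) by auto
      then have "r \<notin> f z" using sub[of r] van zy S(1) by auto
      then have "f z \<in> f ` (T \<inter> U)"
        using r open_Spec_prime[OF P fP[OF zy(1)]] unfolding S(2) by auto
      then show "z \<in> T" using inj zy by (auto simp: inj_on_def)
    qed
    then show "generizes X z y" using zy UX by (auto simp: generizes_def in_closure_of)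
  next
    fix V y s assume V: "is_open X V" "V \<subseteq> U" "y \<in> V" "s \<in> carrier (sections X V)"
    let ?V = "f ` V"
    have V': "is_open ?Y ?V" by (rule open_image[OF V(1,2)])
    have preV: "preimage ?X f ?V = V"
      using V pts inj by (auto simp: preimage_def inj_on_def)
    obtain \<sigma> where \<sigma>: "\<sigma> \<in> carrier (sections ?Y ?V)" "s = \<phi> ?V \<sigma>"
      using I.bij[OF V'] V(4) preV by (auto simp: bij_betw_def)
    obtain V2 a t where V2: "is_open ?Y V2" "f y \<in> V2" "V2 \<subseteq> ?V" "a \<in> carrier R" "t \<in> carrier R"
        "t \<notin> f y"
      and eq: "fraction_section R V2 t \<one>\<^bsub>R\<^esub> \<otimes>\<^bsub>sections ?Y V2\<^esub> restr ?Y ?V V2 \<sigma> =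
        fraction_section R V2 a \<one>\<^bsub>R\<^esub>"
      using spec_section_locally_fraction[OF \<sigma>(1), of "f y"] V(3) by blast
    define W where "W = preimage ?X f V2"
    have V2P: "V2 \<subseteq> ?P" using V2 openin_subset by auto
    have W: "is_open X W" "y \<in> W" "W \<subseteq> V"
    proof -
      show "is_open X W" using I.preimage_open[OF V2(1)] open_iff by (simp add: W_def)
      show "y \<in> W" using V V2 pts by (auto simp: W_def preimage_def)
      show "W \<subseteq> V" using V2(3) preV by (auto simp: W_def preimage_def)
    qed
    have h_restr: "restr X U W (?h r) = \<phi> V2 (fraction_section R V2 r \<one>\<^bsub>R\<^esub>)" if "r \<in> carrier R" for r
      using I.natural[OF P V2(1) V2P const[OF that]] pre V2P by (simp add: W_def restr_fraction_section)
    have s_restr: "restr X V W s = \<phi> V2 (restr ?Y ?V V2 \<sigma>)"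
      using I.natural[OF V' V2(1,3) \<sigma>(1)] preV \<sigma>(2) by (simp add: W_def)
    have "fraction_section R V2 t \<one>\<^bsub>R\<^esub> \<in> carrier (sections ?Y V2)"
      using V2 V2P one by (intro fraction_section_closed) auto
    then have "restr X U W (?h t) \<otimes>\<^bsub>sections X W\<^esub> restr X V W s = restr X U W (?h a)"
      using ring_hom_mult[OF I.hom[OF V2(1)], of "fraction_section R V2 t \<one>\<^bsub>R\<^esub>" "restr ?Y ?V V2 \<sigma>"]
        I.Y.restr_closed[OF V' V2(1,3) \<sigma>(1)] eq
      unfolding h_restr[OF V2(4)] h_restr[OF V2(5)] s_restr by (simp add: W_def)
    moreover have "\<not> vanishes X y U (?h t)" using van V V2 by blast
    ultimately show "\<exists>W a t. is_open X W \<and> y \<in> W \<and> W \<subseteq> V \<and> a \<in> carrier R \<and> t \<in> carrier R \<and>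
        \<not> vanishes X y U (?h t) \<and>
        restr X U W (?h t) \<otimes>\<^bsub>sections X W\<^esub> restr X V W s = restr X U W (?h a)"
      using W V2(4,5) by blast
  qed
qed

lemma (in scheme) exists_affine_chart:
  assumes "x \<in> points X"
  obtains U and R :: "'b ring" and h where "x \<in> U" "affine_chart X U R h"
  using locally_affine[OF assms] affine_chart_of_isomorphism by blast

section \<open>The least leaf\<close>

text \<open>
  The sections that vanish to infinite order at \<open>x\<close> along the flow of \<open>\<D>\<close>. Passing to the limit over
  the neighbourhoods \<open>U\<close> of \<open>x\<close>, this is the largest ideal of the local ring at \<open>x\<close> that is proper
  and stable under the derivation.
\<close>

definition flow_core :: "('a, 'b) ringed_space \<Rightarrow> ('a set \<Rightarrow> 'b \<Rightarrow> 'b) \<Rightarrow> 'a \<Rightarrow> 'a set \<Rightarrow> 'b set" where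
  "flow_core X \<D> x U =
    {s \<in> carrier (sections X U). \<forall>n. vanishes X x U ((\<D> U ^^ n) s)}"

context scheme_over_rat
begin

lemma flow_core_stable_core:
  assumes D: "vector_field X \<D>" and U: "is_open X U"
  shows "flow_core X \<D> x U =
    derivation.stable_core (sections X U) (\<D> U) {s \<in> carrier (sections X U). vanishes X x U s}"
proof -
  interpret derivation "sections X U" "\<D> U" by (rule vector_field.derivation[OF D U])
  show ?thesis by (auto simp: flow_core_def stable_core_def funpow_closed)
qed

lemma flow_core_prime:
  assumes D: "vector_field X \<D>" and U: "is_open X U" "x \<in> U"
  shows "primeideal (flow_core X \<D> x U) (sections X U)"
proof -
  interpret derivation "sections X U" "\<D> U" by (rule vector_field.derivation[OF D U(1)])
  show ?thesis
    unfolding flow_core_stable_core[OF D U(1)]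
    by (rule stable_core_prime[OF vanishing_sections_prime[OF U]])
      (use nat_multiple_nonvanishing[OF U] in blast)
qed

lemma flow_core_vanishes: "s \<in> flow_core X \<D> x U \<Longrightarrow> vanishes X x U s"
  unfolding flow_core_def mem_Collect_eq by (metis funpow_0)

lemma flow_core_closed:
  assumes D: "vector_field X \<D>" and U: "is_open X U" and s: "s \<in> flow_core X \<D> x U"
  shows "\<D> U s \<in> flow_core X \<D> x U"
proof -
  interpret derivation "sections X U" "\<D> U" by (rule vector_field.derivation[OF D U])
  show ?thesis using s stable_core_closed unfolding flow_core_stable_core[OF D U] by blast
qed

lemma restr_funpow:
  assumes D: "vector_field X \<D>" and UW: "is_open X U" "is_open X W" "W \<subseteq> U"
    and s: "s \<in> carrier (sections X U)"
  shows "restr X U W ((\<D> U ^^ n) s) = (\<D> W ^^ n) (restr X U W s)"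
proof -
  interpret derivation "sections X U" "\<D> U" by (rule vector_field.derivation[OF D UW(1)])
  show ?thesis
    using UW s by (induction n) (simp_all add: vector_field.compatible[OF D] funpow_closed)
qed

lemma restr_mem_flow_core_iff:
  assumes D: "vector_field X \<D>" and UW: "is_open X U" "is_open X W" "W \<subseteq> U" "x \<in> W"
    and s: "s \<in> carrier (sections X U)"
  shows "restr X U W s \<in> flow_core X \<D> x W \<longleftrightarrow> s \<in> flow_core X \<D> x U"
proof -
  interpret derivation "sections X U" "\<D> U" by (rule vector_field.derivation[OF D UW(1)])
  have "vanishes X x W ((\<D> W ^^ n) (restr X U W s)) \<longleftrightarrow> vanishes X x U ((\<D> U ^^ n) s)" for n
    using vanishes_restr[OF UW(1,2,4,3) funpow_closed[OF s]] restr_funpow[OF D UW(1,2,3) s] by simp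
  then show ?thesis using s UW by (simp add: flow_core_def restr_closed)
qed

end

text \<open>
  Inside an affine chart around \<open>x\<close>, let \<open>\<eta>\<^sub>0\<close> be the point whose prime is the contraction of the
  flow core to the coordinate ring. The work lies in passing from the coordinate ring, on which the
  prime of \<open>\<eta>\<^sub>0\<close> is known, to all sections, on which \<open>\<D>\<close> acts; this is done by writing sections as
  fractions, near \<open>x\<close> to describe the sections over \<open>U\<close> that vanish at \<open>\<eta>\<^sub>0\<close>, and near \<open>\<eta>\<^sub>0\<close> to see
  that \<open>\<eta>\<^sub>0\<close> is a leaf.
\<close>

theorem theorem2p6:
  fixes X :: "('a, 'b) ringed_space"
    and f :: "'a \<Rightarrow> rat set"
    and \<phi> :: "rat set set \<Rightarrow> (rat set \<Rightarrow> (rat \<times> rat) set) \<Rightarrow> 'b"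
    and \<D> :: "'a set \<Rightarrow> 'b \<Rightarrow> 'b"
    and x :: 'a
  assumes "scheme_over_rat X f \<phi>"
    and "vector_field X \<D>"
    and "x \<in> points X"
  shows "\<exists>\<eta>\<^sub>0. least (specialization_order X) \<eta>\<^sub>0 {\<eta> \<in> points X. generizes X \<eta> x \<and> leaf X \<D> \<eta>}"
proof -
  interpret scheme_over_rat X f \<phi> by (rule assms(1))
  note D = assms(2)
  obtain U and R :: "'b ring" and h where xU: "x \<in> U" and chart: "affine_chart X U R h"
    using exists_affine_chart[OF assms(3)] by blast
  interpret A: affine_chart X U R h by (rule chart)
  note U = A.chart_open
  interpret D: derivation "sections X U" "\<D> U" by (rule vector_field.derivation[OF D U])
  interpret R: cring R by (rule A.coordinate_cring)
  interpret h: ring_hom_ring R "sections X U" h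
    by (intro ring_hom_ringI2 R.ring_axioms D.ring_axioms A.coordinate_hom)
  let ?core = "flow_core X \<D> x"
  have in_opens: "z \<in> W" if "generizes X z y" "is_open X W" "y \<in> W" for z y W
    using that by (auto simp: generizes_def in_closure_of)

  have "primeideal {r \<in> carrier R. h r \<in> ?core U} R"
    by (rule h.primeideal_vimage[OF R.cring_axioms flow_core_prime[OF D U xU]])
  then obtain \<eta>\<^sub>0 where \<eta>\<^sub>0: "\<eta>\<^sub>0 \<in> U"
    and van: "\<And>r. r \<in> carrier R \<Longrightarrow> vanishes X \<eta>\<^sub>0 U (h r) \<longleftrightarrow> h r \<in> ?core U"
    using A.point_of_prime by blast
  have gen: "generizes X \<eta>\<^sub>0 x"
    using A.generizesI[OF \<eta>\<^sub>0 xU] van flow_core_vanishes by blast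

  \<comment> \<open>The derivative of a section from \<open>R\<close> need not come from \<open>R\<close>, so the description of the prime of
    \<open>\<eta>\<^sub>0\<close> has to be extended to all sections over \<open>U\<close>. Near \<open>x\<close> such a section \<open>s\<close> satisfies
    \<open>t s = a\<close> with \<open>a\<close>, \<open>t\<close> from \<open>R\<close>, and \<open>t\<close> lies neither in the flow core nor in the prime of
    \<open>\<eta>\<^sub>0\<close>; both are prime, so \<open>t\<close> can be cancelled.\<close>
  have van_core: "vanishes X \<eta>\<^sub>0 U s \<longleftrightarrow> s \<in> ?core U" if s: "s \<in> carrier (sections X U)" for s
  proof -
    obtain W a t where W: "is_open X W" "x \<in> W" "W \<subseteq> U" and at: "a \<in> carrier R" "t \<in> carrier R"
      and t: "\<not> vanishes X x U (h t)"
      and eq: "restr X U W (h t) \<otimes>\<^bsub>sections X W\<^esub> restr X U W s = restr X U W (h a)"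
      using A.locally_fraction[OF U order.refl xU s] by blast
    have \<eta>W: "\<eta>\<^sub>0 \<in> W" by (rule in_opens[OF gen W(1,2)])
    interpret V: primeideal "{s \<in> carrier (sections X W). vanishes X \<eta>\<^sub>0 W s}" "sections X W"
      by (rule vanishing_sections_prime[OF W(1) \<eta>W])
    interpret C: primeideal "?core W" "sections X W" by (rule flow_core_prime[OF D W(1,2)])
    have van_W: "vanishes X \<eta>\<^sub>0 W (restr X U W b) \<longleftrightarrow> vanishes X \<eta>\<^sub>0 U b"
      and core_W: "restr X U W b \<in> ?core W \<longleftrightarrow> b \<in> ?core U"
      and rc: "restr X U W b \<in> carrier (sections X W)"
      if "b \<in> carrier (sections X U)" for b
      by (rule vanishes_restr[OF U W(1) \<eta>W W(3) that] restr_mem_flow_core_iff[OF D U W(1,3,2) that]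
          restr_closed[OF U W(1,3) that])+
    have ht: "h t \<notin> ?core U" using t flow_core_vanishes by blast
    have ha: "h a \<in> carrier (sections X U)" "h t \<in> carrier (sections X U)"
      by (rule h.hom_closed[OF at(1)], rule h.hom_closed[OF at(2)])
    have "restr X U W (h t) \<notin> {s \<in> carrier (sections X W). vanishes X \<eta>\<^sub>0 W s}"
      using ht van[OF at(2)] van_W[OF ha(2)] by blast
    from V.mult_mem_iff[OF rc[OF ha(2)] this rc[OF s]]
    have "vanishes X \<eta>\<^sub>0 W (restr X U W s) \<longleftrightarrow> vanishes X \<eta>\<^sub>0 W (restr X U W (h a))"
      unfolding eq using rc[OF s] rc[OF ha(1)] by blast
    then have "vanishes X \<eta>\<^sub>0 U s \<longleftrightarrow> h a \<in> ?core U"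
      unfolding van_W[OF s] van_W[OF ha(1)] van[OF at(1)] .
    also have "\<dots> \<longleftrightarrow> restr X U W (h a) \<in> ?core W"
      by (rule core_W[OF ha(1), symmetric])
    also have "\<dots> \<longleftrightarrow> restr X U W s \<in> ?core W"
      unfolding eq[symmetric] by (rule C.mult_mem_iff) (use ht core_W[OF ha(2)] rc s ha in blast)+
    also have "\<dots> \<longleftrightarrow> s \<in> ?core U"
      by (rule core_W[OF s])
    finally show ?thesis .
  qed

  \<comment> \<open>Near \<open>\<eta>\<^sub>0\<close> write \<open>t s = a\<close> with \<open>a\<close>, \<open>t\<close> from \<open>R\<close>. If \<open>s\<close> vanishes at \<open>\<eta>\<^sub>0\<close>, then so does \<open>a\<close>;
    hence \<open>a\<close> and its derivative lie in the flow core, and \<open>t \<D> s = \<D> a - \<D> t s\<close> vanishes at \<open>\<eta>\<^sub>0\<close>.\<close>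
  have "leaf X \<D> \<eta>\<^sub>0"
    unfolding leaf_iff[OF D subsetD[OF openin_subset[OF U] \<eta>\<^sub>0]]
  proof (intro allI impI)
    fix V s assume V: "is_open X V" "\<eta>\<^sub>0 \<in> V" "s \<in> carrier (sections X V)" "vanishes X \<eta>\<^sub>0 V s"
    define B where "B = V \<inter> U"
    have B: "is_open X B" "B \<subseteq> U" "\<eta>\<^sub>0 \<in> B" "B \<subseteq> V" using V U \<eta>\<^sub>0 by (auto simp: B_def)
    obtain W a t where W: "is_open X W" "\<eta>\<^sub>0 \<in> W" "W \<subseteq> B" and at: "a \<in> carrier R" "t \<in> carrier R"
      and t: "\<not> vanishes X \<eta>\<^sub>0 U (h t)"
      and eq: "restr X U W (h t) \<otimes>\<^bsub>sections X W\<^esub> restr X B W (restr X V B s) = restr X U W (h a)"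
      using A.locally_fraction[OF B(1,2,3) restr_closed[OF V(1) B(1,4) V(3)]] by blast
    have WU: "W \<subseteq> U" "W \<subseteq> V" using W B by auto
    interpret DW: derivation "sections X W" "\<D> W" by (rule vector_field.derivation[OF D W(1)])
    interpret P: primeideal "{s \<in> carrier (sections X W). vanishes X \<eta>\<^sub>0 W s}" "sections X W"
      by (rule vanishing_sections_prime[OF W(1,2)])
    let ?I = "{s \<in> carrier (sections X W). vanishes X \<eta>\<^sub>0 W s}"
    define s' t' where "s' = restr X V W s" and "t' = restr X U W (h t)"
    have st: "s' \<in> carrier (sections X W)" "t' \<in> carrier (sections X W)"
      unfolding s'_def t'_def using restr_closed[OF V(1) W(1) WU(2) V(3)]
        restr_closed[OF U W(1) WU(1) h.hom_closed[OF at(2)]] by blast+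
    have prod: "t' \<otimes>\<^bsub>sections X W\<^esub> s' = restr X U W (h a)"
      using eq restr_restr[OF V(1) B(1) W(1,3) B(4) V(3)] by (simp add: s'_def t'_def)
    have s': "s' \<in> ?I"
      using st(1) V(4) vanishes_restr[OF V(1) W(1,2) WU(2) V(3)] unfolding s'_def by blast
    have t': "t' \<notin> ?I"
      using t vanishes_restr[OF U W(1,2) WU(1) h.hom_closed[OF at(2)]] unfolding t'_def by blast
    have Dha: "\<D> U (h a) \<in> carrier (sections X U)"
      by (rule D.closed[OF h.hom_closed[OF at(1)]])
    have "t' \<otimes>\<^bsub>sections X W\<^esub> s' \<in> ?I" using P.I_l_closed[OF s' st(2)] .
    then have "h a \<in> ?core U"
      using vanishes_restr[OF U W(1,2) WU(1) h.hom_closed[OF at(1)]] van[OF at(1)]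
      unfolding prod by blast
    then have "vanishes X \<eta>\<^sub>0 U (\<D> U (h a))"
      using flow_core_closed[OF D U] van_core[OF Dha] by blast
    then have "vanishes X \<eta>\<^sub>0 W (restr X U W (\<D> U (h a)))"
      using vanishes_restr[OF U W(1,2) WU(1) Dha] by blast
    then have Da: "\<D> W (t' \<otimes>\<^bsub>sections X W\<^esub> s') \<in> ?I"
      using restr_closed[OF U W(1) WU(1) Dha]
      unfolding prod vector_field.compatible[OF D U W(1) WU(1) h.hom_closed[OF at(1)]] by blast
    moreover have Dts: "\<D> W t' \<otimes>\<^bsub>sections X W\<^esub> s' \<in> ?I"
      by (rule P.I_l_closed[OF s' DW.closed[OF st(2)]])
    ultimately have "\<D> W (t' \<otimes>\<^bsub>sections X W\<^esub> s') \<ominus>\<^bsub>sections X W\<^esub> \<D> W t' \<otimes>\<^bsub>sections X W\<^esub> s' \<in> ?I"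
      unfolding DW.minus_eq by (intro P.a_closed P.a_inv_closed)
    moreover have "\<D> W (t' \<otimes>\<^bsub>sections X W\<^esub> s') \<ominus>\<^bsub>sections X W\<^esub> \<D> W t' \<otimes>\<^bsub>sections X W\<^esub> s' =
        t' \<otimes>\<^bsub>sections X W\<^esub> \<D> W s'"
      using DW.closed[OF st(1)] DW.closed[OF st(2)] st
      by (simp only: DW.leibniz DW.minus_eq DW.a_assoc DW.r_neg DW.m_closed DW.a_inv_closed DW.r_zero)
    ultimately have "\<D> W s' \<in> ?I"
      using P.mult_mem_iff[OF st(2) t' DW.closed[OF st(1)]] by metis
    then show "vanishes X \<eta>\<^sub>0 V (\<D> V s)"
      using vanishes_restr[OF V(1) W(1,2) WU(2)
          derivation.closed[OF vector_field.derivation[OF D V(1)] V(3)]]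
      unfolding s'_def vector_field.compatible[OF D V(1) W(1) WU(2) V(3)] by blast
  qed

  \<comment> \<open>Whatever vanishes at a leaf \<open>\<eta>\<close> vanishes there with all its derivatives, and therefore also at
    every specialization of \<open>\<eta>\<close>.\<close>
  moreover have "generizes X \<eta> \<eta>\<^sub>0" if \<eta>: "generizes X \<eta> x" "leaf X \<D> \<eta>" for \<eta>
  proof -
    have \<eta>U: "\<eta> \<in> U" by (rule in_opens[OF \<eta>(1) U xU])
    have "\<eta> \<in> points X" using \<eta>(1) by (simp add: generizes_def)
    note leaf = \<eta>(2)[unfolded leaf_iff[OF D this], rule_format, OF U \<eta>U]
    have "vanishes X \<eta>\<^sub>0 U (h r)" if r: "r \<in> carrier R" "vanishes X \<eta> U (h r)" for r
    proof -
      have "vanishes X \<eta> U ((\<D> U ^^ n) (h r))" for n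
        using r(2) leaf[OF D.funpow_closed[OF h.hom_closed[OF r(1)]]] by (induction n) auto
      then have "h r \<in> ?core U"
        using vanishes_generization[OF \<eta>(1) U xU] h.hom_closed[OF r(1)]
        unfolding flow_core_def by blast
      then show ?thesis using van[OF r(1)] by simp
    qed
    then show ?thesis by (rule A.generizesI[OF \<eta>U \<eta>\<^sub>0])
  qed
  ultimately show ?thesis
    using gen subsetD[OF openin_subset[OF U] \<eta>\<^sub>0]
    by (intro exI[of _ \<eta>\<^sub>0]) (auto simp: least_def specialization_order_def)
qed

end
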